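(* Let $X$ be a complex Banach space and let $(T(t))_{t\geq 0}$ be a differentiable $C_0$ semigroup on $X$ with infinitesimal generator $A$. Then for every integer $n\geq 1$, every $t>0$ and each $\sigma_*\in\{\sigma,\sigma_{ap}\}$, $$\sigma_*(T(t)^{(n)})\cup\{0\}=\{\lambda^n e^{\lambda t} : \lambda\in\sigma_*(A)\cup\{0\}\}.$$
   Context: A $C_0$ semigroup $(T(t))_{t\ge 0}$ is differentiable if for every $x\in X$ the map $t\mapsto T(t)x$ is differentiable for $t>0$. $T(t)^{(n)}$ denotes the $n$-th derivative at $t$ of the semigroup, a bounded operator on $X$ for $t>0$, given by $T(t)^{(n)}=A^nT(t)$. $\sigma$ denotes the spectrum and $\sigma_{ap}$ the approximate point spectrum: for a closed operator $S$ with domain $D(S)$, $\lambda\in\sigma_{ap}(S)$ iff there is a sequence $(x_n)\subset D(S)$ with $\|x_n\|=1$ and $(\lambda-S)x_n\to 0$. *)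

theory Defs
  imports "HOL-Analysis.Analysis"
begin

class complex_normed_vector = real_normed_vector +
  fixes scaleC :: "complex \<Rightarrow> 'a \<Rightarrow> 'a"  (infixr "*\<^sub>C" 75)
  assumes scaleC_add_right: "c *\<^sub>C (x + y) = c *\<^sub>C x + c *\<^sub>C y"
    and scaleC_add_left: "(c + d) *\<^sub>C x = c *\<^sub>C x + d *\<^sub>C x"
    and scaleC_scaleC: "c *\<^sub>C d *\<^sub>C x = (c * d) *\<^sub>C x"
    and scaleC_of_real: "complex_of_real r *\<^sub>C x = r *\<^sub>R x"
    and norm_scaleC: "norm (c *\<^sub>C x) = cmod c * norm x"

class complex_banach = complex_normed_vector + banach

instantiation complex :: complex_banach
begin

definition scaleC_complex :: "complex \<Rightarrow> complex \<Rightarrow> complex"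
  where "scaleC_complex c x = c * x"

instance
  by standard
    (simp_all add: scaleC_complex_def algebra_simps norm_mult scaleR_conv_of_real)

end

definition bounded_clinear ::
    "('a::complex_normed_vector \<Rightarrow> 'b::complex_normed_vector) \<Rightarrow> bool"
  where "bounded_clinear f \<longleftrightarrow> bounded_linear f \<and> (\<forall>c x. f (c *\<^sub>C x) = c *\<^sub>C f x)"

text \<open>
  A possibly unbounded operator is given by its domain \<open>D\<close> and a function \<open>S\<close> of which only
  the values on \<open>D\<close> matter; a bounded operator has domain \<open>UNIV\<close>.
\<close>

definition op_resolvent_set ::
    "'a::complex_normed_vector set \<Rightarrow> ('a \<Rightarrow> 'a) \<Rightarrow> complex set"
  where "op_resolvent_set D S =
    {z. \<exists>R. bounded_clinear R \<and>
            (\<forall>y. R y \<in> D \<and> z *\<^sub>C R y - S (R y) = y) \<and>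
            (\<forall>x\<in>D. R (z *\<^sub>C x - S x) = x)}"

definition op_spectrum ::
    "'a::complex_normed_vector set \<Rightarrow> ('a \<Rightarrow> 'a) \<Rightarrow> complex set"
  where "op_spectrum D S = - op_resolvent_set D S"

definition op_approx_point_spectrum ::
    "'a::complex_normed_vector set \<Rightarrow> ('a \<Rightarrow> 'a) \<Rightarrow> complex set"
  where "op_approx_point_spectrum D S =
    {z. \<exists>x :: nat \<Rightarrow> 'a. (\<forall>k. x k \<in> D \<and> norm (x k) = 1) \<and>
            (\<lambda>k. z *\<^sub>C x k - S (x k)) \<longlonglongrightarrow> 0}"

text \<open>Only the values of \<open>T\<close> at nonnegative times matter.\<close>

definition C0_semigroup :: "(real \<Rightarrow> 'a::complex_banach \<Rightarrow> 'a) \<Rightarrow> bool"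
  where "C0_semigroup T \<longleftrightarrow>
    (\<forall>t\<ge>0. bounded_clinear (T t)) \<and>
    (\<forall>x. T 0 x = x) \<and>
    (\<forall>s\<ge>0. \<forall>t\<ge>0. \<forall>x. T (s + t) x = T s (T t x)) \<and>
    (\<forall>x. ((\<lambda>t. T t x) \<longlongrightarrow> x) (at_right 0))"

definition differentiable_semigroup :: "(real \<Rightarrow> 'a::complex_banach \<Rightarrow> 'a) \<Rightarrow> bool"
  where "differentiable_semigroup T \<longleftrightarrow>
    C0_semigroup T \<and> (\<forall>x. \<forall>t>0. (\<lambda>s. T s x) differentiable (at t))"

definition generator_domain :: "(real \<Rightarrow> 'a::complex_banach \<Rightarrow> 'a) \<Rightarrow> 'a set"
  where "generator_domain T =
    {x. \<exists>y. ((\<lambda>h. (T h x - x) /\<^sub>R h) \<longlongrightarrow> y) (at_right 0)}"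

definition generator :: "(real \<Rightarrow> 'a::complex_banach \<Rightarrow> 'a) \<Rightarrow> 'a \<Rightarrow> 'a"
  where "generator T x = Lim (at_right 0) (\<lambda>h. (T h x - x) /\<^sub>R h)"

text \<open>
  The \<open>n\<close>-th derivative of the semigroup at \<open>t > 0\<close>, taken pointwise. For a differentiable
  \<open>C\<^sub>0\<close> semigroup all these derivatives exist, they are the bounded operators \<open>A\<^sup>n T(t)\<close>
  (with \<open>A\<close> the generator), and they agree with the derivatives in operator norm.
\<close>

primrec semigroup_deriv ::
    "(real \<Rightarrow> 'a::complex_banach \<Rightarrow> 'a) \<Rightarrow> nat \<Rightarrow> real \<Rightarrow> 'a \<Rightarrow> 'a"
  where
    "semigroup_deriv T 0 t x = T t x"
  | "semigroup_deriv T (Suc n) t x = vector_derivative (\<lambda>s. semigroup_deriv T n s x) (at t)"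

end

theory Submission
  imports Defs
begin

text \<open>
  Write \<open>f z = z\<^sup>n e\<^sup>z\<^sup>t\<close> and \<open>F = A\<^sup>n T(t)\<close>. There is a bounded operator \<open>L\<close> with
  \<open>f z - F = L (z - A) = (z - A) L\<close>, which gives the inclusion of the images under \<open>f\<close>.

  Conversely, let \<open>w \<noteq> 0\<close>. Modulo \<open>w - F\<close> the generator agrees with the bounded operator
  \<open>B = A F / w\<close>, so it suffices to find \<open>z\<close> in the spectrum of \<open>B\<close> relative to a seminorm in which
  \<open>w - F\<close> is small: then \<open>z\<close> belongs to the spectrum of \<open>A\<close>, and the factorization forces
  \<open>f z = w\<close>. The seminorm is the norm if \<open>w\<close> is an approximate eigenvalue of \<open>F\<close>, and otherwise the
  distance to the proper closed range of \<open>w - F\<close>. The approximate eigenvalue of \<open>B\<close> comes from a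
  variant of Rickart's elementary proof that spectra are nonempty, which needs neither completeness
  nor complex analysis.
\<close>

section \<open>Bounded complex-linear operators\<close>

lemma scaleC_one [simp]: "1 *\<^sub>C x = (x :: 'a::complex_normed_vector)"
  using scaleC_of_real[of 1 x] by simp

lemma scaleC_zero_left [simp]: "0 *\<^sub>C x = (0 :: 'a::complex_normed_vector)"
  using scaleC_of_real[of 0 x] by simp

lemma scaleC_zero_right [simp]: "c *\<^sub>C 0 = (0 :: 'a::complex_normed_vector)"
  using scaleC_add_right[of c 0 0] by simp

lemma scaleC_minus_left [simp]: "(- c) *\<^sub>C x = - (c *\<^sub>C (x :: 'a::complex_normed_vector))"
  using scaleC_add_left[of c "- c" x] by (simp add: eq_neg_iff_add_eq_0 add.commute)

lemma scaleC_minus_right [simp]: "c *\<^sub>C (- x) = - (c *\<^sub>C (x :: 'a::complex_normed_vector))"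
  using scaleC_add_right[of c x "- x"] by (simp add: eq_neg_iff_add_eq_0 add.commute)

lemma scaleC_diff_left: "(c - d) *\<^sub>C x = c *\<^sub>C x - d *\<^sub>C (x :: 'a::complex_normed_vector)"
  using scaleC_add_left[of c "- d" x] by simp

lemma scaleC_diff_right: "c *\<^sub>C (x - y) = c *\<^sub>C x - c *\<^sub>C (y :: 'a::complex_normed_vector)"
  using scaleC_add_right[of c x "- y"] by simp

lemmas scaleC_algebra = scaleC_add_right scaleC_add_left scaleC_diff_right scaleC_diff_left
  scaleC_scaleC

lemma bounded_linear_scaleC_right:
  "bounded_linear (\<lambda>x :: 'a::complex_normed_vector. c *\<^sub>C x)"
proof (rule bounded_linear_intro[where K = "cmod c"])
  fix r and x :: 'a
  show "c *\<^sub>C r *\<^sub>R x = r *\<^sub>R c *\<^sub>C x"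
    by (simp flip: scaleC_of_real add: scaleC_scaleC mult.commute)
qed (simp_all add: scaleC_add_right norm_scaleC mult.commute)

lemma bounded_linear_scaleC_left:
  "bounded_linear (\<lambda>c. c *\<^sub>C (x :: 'a::complex_normed_vector))"
proof (rule bounded_linear_intro[where K = "norm x"])
  fix r and c :: complex
  show "(r *\<^sub>R c) *\<^sub>C x = r *\<^sub>R c *\<^sub>C x"
    by (metis scaleC_of_real scaleC_scaleC scaleR_conv_of_real)
qed (simp_all add: scaleC_add_left norm_scaleC)

lemma bounded_bilinear_scaleC:
  "bounded_bilinear (\<lambda>c (x :: 'a::complex_normed_vector). c *\<^sub>C x)"
  using linear_scale[OF bounded_linear.linear[OF bounded_linear_scaleC_left]]
    linear_scale[OF bounded_linear.linear[OF bounded_linear_scaleC_right]]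
  by (auto intro!: bounded_bilinear.intro exI[of _ 1]
      simp: scaleC_add_right scaleC_add_left norm_scaleC)

lemma bounded_clinearD:
  assumes "bounded_clinear f"
  shows "bounded_linear f" "f (x + y) = f x + f y" "f (x - y) = f x - f y" "f (- x) = - f x"
    "f 0 = 0" "f (c *\<^sub>C x) = c *\<^sub>C f x" "f (r *\<^sub>R x) = r *\<^sub>R f x"
  using assms linear_add[of f] linear_diff[of f] linear_neg[of f] linear_0[of f] linear_scale[of f]
  by (auto simp: bounded_clinear_def bounded_linear.linear)

lemma bounded_clinear_bound:
  assumes "bounded_clinear f"
  obtains K where "K > 0" "\<And>x. norm (f x) \<le> K * norm x"
  using bounded_linear.pos_bounded[OF bounded_clinearD(1)[OF assms]] by (auto simp: mult.commute)

lemma bounded_clinear_compose: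
  assumes "bounded_clinear f" "bounded_clinear g"
  shows "bounded_clinear (\<lambda>x. f (g x))"
  using assms bounded_linear_compose[of f g] by (auto simp: bounded_clinear_def)

lemma bounded_clinear_add:
  assumes "bounded_clinear f" "bounded_clinear g"
  shows "bounded_clinear (\<lambda>x. f x + g x)"
  using assms bounded_linear_add[of f g] by (auto simp: bounded_clinear_def scaleC_add_right)

lemma bounded_clinear_diff:
  assumes "bounded_clinear f" "bounded_clinear g"
  shows "bounded_clinear (\<lambda>x. f x - g x)"
  using assms bounded_linear_sub[of f g] by (auto simp: bounded_clinear_def scaleC_diff_right)

lemma bounded_clinear_zero: "bounded_clinear (\<lambda>x. 0)"
  by (simp add: bounded_clinear_def bounded_linear_zero)

lemma bounded_clinear_scaleC: "bounded_clinear (\<lambda>x. c *\<^sub>C x)"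
  by (simp add: bounded_clinear_def bounded_linear_scaleC_right scaleC_scaleC mult.commute)

lemma bounded_clinear_scaleC_compose:
  "bounded_clinear f \<Longrightarrow> bounded_clinear (\<lambda>x. c *\<^sub>C f x)"
  by (rule bounded_clinear_compose[OF bounded_clinear_scaleC])

text \<open>By Baire, some set \<open>{x. \<forall>i. norm (f i x) \<le> n}\<close> has an
  interior point.\<close>

lemma uniform_boundedness:
  fixes f :: "'i \<Rightarrow> 'a::banach \<Rightarrow> 'b::real_normed_vector"
  assumes lin: "\<And>i. i \<in> I \<Longrightarrow> bounded_linear (f i)"
    and pw: "\<And>x. \<exists>M. \<forall>i\<in>I. norm (f i x) \<le> M"
  shows "\<exists>K>0. \<forall>i\<in>I. \<forall>x. norm (f i x) \<le> K * norm x"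
proof -
  define E where "E n = {x. \<forall>i\<in>I. norm (f i x) \<le> real n}" for n
  have closed: "closed (E n)" for n
  proof -
    have "E n = (\<Inter>i\<in>I. {x. norm (f i x) \<le> real n})"
      by (auto simp: E_def)
    moreover have "closed {x. norm (f i x) \<le> real n}" if "i \<in> I" for i
      by (intro closed_Collect_le continuous_intros linear_continuous_on lin[OF that])
    ultimately show ?thesis by auto
  qed
  have "\<exists>n. interior (E n) \<noteq> {}"
  proof (rule ccontr)
    assume "\<not> ?thesis"
    then have "interior (\<Union>(range E)) = {}"
      using Met_TC.metric_Baire_category_alt[of "range E"] closed complete_UNIV
      by auto
    moreover have "\<Union>(range E) = UNIV"
    proof safe
      fix x
      obtain M where M: "\<forall>i\<in>I. norm (f i x) \<le> M" using pw by blast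
      obtain n where "M \<le> real n" using real_arch_simple by blast
      then have "x \<in> E n" using M by (force simp: E_def)
      then show "x \<in> \<Union>(range E)" by blast
    qed auto
    ultimately show False by simp
  qed
  then obtain n x0 where "x0 \<in> interior (E n)" by auto
  then obtain e where e: "e > 0" "cball x0 e \<subseteq> E n"
    using mem_interior_cball by blast
  \<comment> \<open>A multiple of \<open>x\<close> of length \<open>e\<close> is the difference of
    two points of the ball inside \<open>E n\<close>, hence the bound \<open>2 n / e\<close>. The
    added 1 keeps the constant positive when \<open>n = 0\<close>.\<close>
  have "norm (f i x) \<le> (2 * real n / e + 1) * norm x" if i: "i \<in> I" for i x
  proof (cases "x = 0")
    case True
    then show ?thesis using lin[OF i] by (simp add: linear_0 bounded_linear.linear)
  next
    case False
    define r where "r = e / norm x"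
    have r: "r > 0" using False e by (simp add: r_def)
    have "x0 + r *\<^sub>R x \<in> cball x0 e" "x0 \<in> cball x0 e"
      using False e by (auto simp: dist_norm r_def)
    then have "norm (f i (x0 + r *\<^sub>R x)) \<le> n" "norm (f i x0) \<le> n"
      using subsetD[OF e(2)] i unfolding E_def by blast+
    moreover have "r *\<^sub>R f i x = f i (x0 + r *\<^sub>R x) - f i x0"
      using lin[OF i] by (simp add: linear_add linear_scale bounded_linear.linear)
    moreover have "norm (f i (x0 + r *\<^sub>R x) - f i x0) \<le> norm (f i (x0 + r *\<^sub>R x)) + norm (f i x0)"
      by (rule norm_triangle_ineq4)
    ultimately have "norm (r *\<^sub>R f i x) \<le> 2 * real n"
      by (simp del: norm_scaleR)
    then have "norm (f i x) \<le> 2 * real n / r"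
      using r by (simp add: field_simps)
    also have "\<dots> = 2 * real n / e * norm x"
      by (simp add: r_def)
    also have "\<dots> \<le> (2 * real n / e + 1) * norm x"
      by (simp add: algebra_simps)
    finally show ?thesis .
  qed
  moreover have "2 * real n / e + 1 > 0" using e by (simp add: add_nonneg_pos)
  ultimately show ?thesis by blast
qed

text \<open>Convergent sequences are bounded, so uniform boundedness supplies one constant for all
  \<open>f k\<close>, and it passes to the limit. This is how the derivatives of the semigroup are
  seen to be bounded operators.\<close>

lemma bounded_clinear_pointwise_limit:
  fixes f :: "nat \<Rightarrow> 'a::complex_banach \<Rightarrow> 'b::complex_normed_vector"
  assumes f: "\<And>k. bounded_clinear (f k)"
    and lim: "\<And>x. (\<lambda>k. f k x) \<longlonglongrightarrow> g x"
  shows "bounded_clinear g"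
proof -
  have "\<exists>K>0. \<forall>k\<in>UNIV. \<forall>x. norm (f k x) \<le> K * norm x"
  proof (rule uniform_boundedness)
    fix x
    have "Bseq (\<lambda>k. f k x)"
      using lim convergentI convergent_imp_Bseq by blast
    then show "\<exists>M. \<forall>k\<in>UNIV. norm (f k x) \<le> M"
      by (auto simp: Bseq_def)
  qed (use f in \<open>auto simp: bounded_clinear_def\<close>)
  then obtain K where K: "\<And>k x. norm (f k x) \<le> K * norm x" by auto
  have clin: "g (x + y) = g x + g y" "g (c *\<^sub>C x) = c *\<^sub>C g x" for x y c
  proof -
    have "(\<lambda>k. f k (x + y)) \<longlonglongrightarrow> g x + g y"
      using tendsto_add[OF lim lim] bounded_clinearD(2)[OF f] by simp
    then show "g (x + y) = g x + g y" using LIMSEQ_unique lim by blast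
    have "(\<lambda>k. f k (c *\<^sub>C x)) \<longlonglongrightarrow> c *\<^sub>C g x"
      using bounded_linear.tendsto[OF bounded_linear_scaleC_right lim] bounded_clinearD(6)[OF f]
      by simp
    then show "g (c *\<^sub>C x) = c *\<^sub>C g x" using LIMSEQ_unique lim by blast
  qed
  have "norm (g x) \<le> norm x * K" for x
    by (rule Lim_bounded[OF tendsto_norm[OF lim], of 0]) (use K in \<open>auto simp: mult.commute\<close>)
  then show ?thesis
    unfolding bounded_clinear_def
    using clin by (auto intro!: bounded_linear_intro simp flip: scaleC_of_real)
qed

section \<open>Joint approximate eigenvalues\<close>

lemma power_two_power_Suc: "x ^ 2 ^ Suc k = x ^ 2 ^ k * (x :: 'a::monoid_mult) ^ 2 ^ k"
  by (simp add: mult_2 power_add)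

section \<open>Inequalities modulo a commuting operator\<close>

locale commuting_seminorm =
  fixes p :: "'a::complex_normed_vector \<Rightarrow> real" and B G :: "'a \<Rightarrow> 'a" and K :: real
  assumes p_nonneg: "p x \<ge> 0"
    and p_add: "p (x + y) \<le> p x + p y"
    and p_scaleC: "p (c *\<^sub>C x) \<le> cmod c * p x"
    and B_add: "B (x + y) = B x + B y"
    and B_scaleC: "B (c *\<^sub>C x) = c *\<^sub>C B x"
    and B_bound: "p (B x) \<le> K * p x"
    and K_pos: "K > 0"
    and G_add: "G (x + y) = G x + G y"
    and G_scaleC: "G (c *\<^sub>C x) = c *\<^sub>C G x"
    and G_B: "G (B x) = B (G x)"
begin

text \<open>Inequality up to an error that vanishes along any sequence with \<open>p (G v)\<close>
  tending to 0; \<open>C\<close> may differ between inequalities but not with \<open>v\<close>. The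
  calculus treats \<open>G\<close> as zero.\<close>

definition dom :: "('a \<Rightarrow> real) \<Rightarrow> ('a \<Rightarrow> real) \<Rightarrow> bool"  (infix \<open>\<preceq>\<close> 50)
  where "f \<preceq> g \<longleftrightarrow> (\<exists>C\<ge>0. \<forall>v. f v \<le> g v + C * p (G v))"

text \<open>The operators that may be substituted into such an inequality: commutation turns the
  error \<open>p (G (L v))\<close> into \<open>p (L (G v))\<close>, which boundedness for
  \<open>p\<close> controls.\<close>

definition adm :: "('a \<Rightarrow> 'a) \<Rightarrow> bool"
  where "adm L \<longleftrightarrow> (\<exists>M\<ge>0. \<forall>v. p (L v) \<le> M * p v) \<and> (\<forall>v. G (L v) = L (G v))"

definition S :: "nat \<Rightarrow> 'a \<Rightarrow> 'a"
  where "S k = B ^^ (2 ^ k)"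

text \<open>The denominators \<open>a - x\<close> at \<open>x = B ^^ (2 ^ k)\<close>. Inverses need
  not exist, so resolvent identities are kept in multiplied-out form.\<close>

definition X :: "complex \<Rightarrow> nat \<Rightarrow> 'a \<Rightarrow> 'a"
  where "X a k v = a *\<^sub>C v - S k v"

lemma domI: "(\<And>v. f v \<le> g v) \<Longrightarrow> f \<preceq> g"
  unfolding dom_def by (rule exI[of _ 0]) simp

lemma dom_trans [trans]:
  assumes "f \<preceq> g" "g \<preceq> h" shows "f \<preceq> h"
proof -
  obtain C1 C2 where C: "C1 \<ge> 0" "\<And>v. f v \<le> g v + C1 * p (G v)"
    "C2 \<ge> 0" "\<And>v. g v \<le> h v + C2 * p (G v)"
    using assms unfolding dom_def by blast
  have "f v \<le> h v + (C1 + C2) * p (G v)" for v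
    using C(2,4)[of v] by (simp add: algebra_simps)
  then show ?thesis unfolding dom_def using C(1,3) by (intro exI[of _ "C1 + C2"]) auto
qed

lemma dom_add:
  assumes "f \<preceq> g" "f' \<preceq> g'" shows "(\<lambda>v. f v + f' v) \<preceq> (\<lambda>v. g v + g' v)"
proof -
  obtain C1 C2 where C: "C1 \<ge> 0" "\<And>v. f v \<le> g v + C1 * p (G v)"
    "C2 \<ge> 0" "\<And>v. f' v \<le> g' v + C2 * p (G v)"
    using assms unfolding dom_def by blast
  have "f v + f' v \<le> g v + g' v + (C1 + C2) * p (G v)" for v
    using C(2,4)[of v] by (simp add: algebra_simps)
  then show ?thesis unfolding dom_def using C(1,3) by (intro exI[of _ "C1 + C2"]) auto
qed

lemma dom_mult:
  assumes "f \<preceq> g" "0 \<le> a" shows "(\<lambda>v. a * f v) \<preceq> (\<lambda>v. a * g v)"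
proof -
  obtain C where C: "C \<ge> 0" "\<And>v. f v \<le> g v + C * p (G v)"
    using assms unfolding dom_def by blast
  have "a * f v \<le> a * g v + (a * C) * p (G v)" for v
    using mult_left_mono[OF C(2)[of v] \<open>0 \<le> a\<close>] by (simp add: algebra_simps)
  then show ?thesis unfolding dom_def using C assms by (intro exI[of _ "a * C"]) auto
qed

lemma dom_adm:
  assumes "f \<preceq> g" "adm L" shows "(\<lambda>v. f (L v)) \<preceq> (\<lambda>v. g (L v))"
proof -
  obtain C where C: "C \<ge> 0" "\<And>v. f v \<le> g v + C * p (G v)"
    using assms unfolding dom_def by blast
  obtain M where M: "M \<ge> 0" "\<And>v. p (L v) \<le> M * p v" "\<And>v. G (L v) = L (G v)"
    using assms unfolding adm_def by blast
  have "f (L v) \<le> g (L v) + (C * M) * p (G v)" for v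
    using C(2)[of "L v"] mult_left_mono[OF M(2)[of "G v"] C(1)] M(3)[of v]
    by (simp add: algebra_simps)
  then show ?thesis unfolding dom_def using C M by (intro exI[of _ "C * M"]) auto
qed

lemma p_diff: "p (x - y) \<le> p x + p y"
  using p_add[of x "- y"] p_scaleC[of "-1" y] by simp

lemma p_scaleC_eq: "p (c *\<^sub>C x) = cmod c * p x"
proof (cases "c = 0")
  case True
  then show ?thesis using p_scaleC[of 0 x] p_nonneg[of 0] by simp
next
  case False
  have "p x \<le> cmod (inverse c) * p (c *\<^sub>C x)"
    using p_scaleC[of "inverse c" "c *\<^sub>C x"] False by (simp add: scaleC_scaleC)
  then have "cmod c * p x \<le> p (c *\<^sub>C x)"
    using False by (simp add: norm_inverse norm_divide field_simps)
  then show ?thesis using p_scaleC[of c x] by simp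
qed

lemma adm_comp: "adm L \<Longrightarrow> adm L' \<Longrightarrow> adm (\<lambda>v. L (L' v))"
proof -
  assume "adm L" "adm L'"
  then obtain M M' where M: "M \<ge> 0" "\<And>v. p (L v) \<le> M * p v" "\<And>v. G (L v) = L (G v)"
    "M' \<ge> 0" "\<And>v. p (L' v) \<le> M' * p v" "\<And>v. G (L' v) = L' (G v)"
    unfolding adm_def by blast
  have "p (L (L' v)) \<le> (M * M') * p v" for v
    using M(2)[of "L' v"] mult_left_mono[OF M(5)[of v] M(1)] by (simp add: mult.assoc)
  then show ?thesis unfolding adm_def using M by (metis mult_nonneg_nonneg)
qed

lemma adm_B: "adm B"
  using B_bound K_pos G_B unfolding adm_def by (meson less_imp_le)

lemma adm_S: "adm (S k)"
proof -
  have "adm (B ^^ n)" for n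
  proof (induction n)
    case 0
    show ?case unfolding adm_def by (auto intro: exI[of _ 1])
  next
    case (Suc n)
    show ?case using adm_comp[OF adm_B Suc] by (simp add: o_def)
  qed
  then show ?thesis by (simp add: S_def)
qed

lemma G_minus: "G (- x) = - G x"
  using G_scaleC[of "-1" x] by simp

lemma adm_X: "adm (X a k)"
proof -
  obtain M where M: "M \<ge> 0" "\<And>v. p (S k v) \<le> M * p v" "\<And>v. G (S k v) = S k (G v)"
    using adm_S[of k] unfolding adm_def by blast
  have "p (X a k v) \<le> (cmod a + M) * p v" for v
    using p_diff[of "a *\<^sub>C v" "S k v"] p_scaleC[of a v] M(2)[of v]
    by (simp add: X_def algebra_simps)
  moreover have "G (X a k v) = X a k (G v)" for v
    using G_add[of "a *\<^sub>C v" "- S k v"] M(3)[of v] by (simp add: X_def G_scaleC G_minus)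
  ultimately show ?thesis unfolding adm_def using M(1) by (intro conjI exI[of _ "cmod a + M"]) auto
qed

lemma S_add: "S k (x + y) = S k x + S k y"
  and S_scaleC: "S k (c *\<^sub>C x) = c *\<^sub>C S k x"
proof -
  have "(B ^^ n) (x + y) = (B ^^ n) x + (B ^^ n) y \<and> (B ^^ n) (c *\<^sub>C x) = c *\<^sub>C (B ^^ n) x" for n
    by (induction n) (auto simp: B_add B_scaleC)
  then show "S k (x + y) = S k x + S k y" "S k (c *\<^sub>C x) = c *\<^sub>C S k x"
    by (auto simp: S_def)
qed

lemma S_minus: "S k (- x) = - S k x"
  using S_scaleC[of k "-1" x] by simp

lemma S_diff: "S k (x - y) = S k x - S k y"
  using S_add[of k x "- y"] by (simp add: S_minus)

lemma S_0: "S 0 = B"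
  by (simp add: S_def)

lemma S_Suc: "S (Suc k) v = S k (S k v)"
  by (simp add: S_def mult_2 funpow_add)

lemmas expand = X_def S_Suc S_add S_diff S_scaleC S_minus scaleC_algebra

text \<open>Each pair \<open>(b - x) (- b - x)\<close> equals \<open>x\<^sup>2 - b\<^sup>2\<close>,
  and the two signs cancel. Both orders are listed because the induction hypothesis is applied once
  for each square root.\<close>

lemma X_product:
  "X b k (X b' k (X (- b) k (X (- b') k v))) = X (b * b) (Suc k) (X (b' * b') (Suc k) v)"
  "X (- b) k (X (- b') k (X b k (X b' k v))) = X (b * b) (Suc k) (X (b' * b') (Suc k) v)"
  by (simp_all add: expand algebra_simps)

lemma scaleC_mult_2_right: "(c * 2) *\<^sub>C x = c *\<^sub>C x + c *\<^sub>C (x :: 'a)"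
  by (metis mult_2_right scaleC_add_left)

text \<open>With \<open>x = S k\<close>, the constant and quadratic terms of
  \<open>(b + x) (b' + x)\<close> and \<open>(b - x) (b' - x)\<close> cancel, leaving
  \<open>2 (b + b') x\<close>.\<close>

lemma X_difference:
  "S k (X (- b) k (X (- b') k v)) - S k (X b k (X b' k v)) = ((b + b') + (b + b')) *\<^sub>C S (Suc k) v"
  by (simp add: expand algebra_simps scaleC_mult_2_right)

text \<open>The resolvent identity for \<open>x / (a - x)\<close> survives the passage from \<open>x\<close> to \<open>x\<^sup>2\<close>: with
  \<open>a = b\<^sup>2\<close>, the function \<open>a / (a - x\<^sup>2)\<close> is the mean of \<open>b / (b - x)\<close> and \<open>- b / (- b - x)\<close>.\<close>

lemma dyadic_power_bound:
  assumes r: "0 < r" "r < r'" "r' \<le> R" and c: "c > 0"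
    and lower: "\<And>z. cmod z \<le> R \<Longrightarrow> (\<lambda>v. c * p v) \<preceq> (\<lambda>v. p (z *\<^sub>C v - B v))"
    and u: "cmod u = 1"
  shows "(\<lambda>v. (r' ^ 2 ^ k - r ^ 2 ^ k) * p (S k v)) \<preceq>
    (\<lambda>v. ((r' - r) * K / c\<^sup>2) * p (X (of_real r ^ 2 ^ k * u) k (X (of_real r' ^ 2 ^ k * u) k v)))"
  using u
proof (induction k arbitrary: u)
  \<comment> \<open>The numerator \<open>x\<close> costs \<open>K\<close> and each of the two
    denominators costs \<open>1 / c\<close>, whence the constant
    \<open>(r' - r) * K / c\<^sup>2\<close>; the doubling step keeps it unchanged.\<close>
  case 0
  have eq: "((r' - r) * K / c\<^sup>2) * (c * (c * x)) = (r' - r) * (K * x)" for x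
    using c by (simp add: power2_eq_square)
  let ?z = "of_real r * u" and ?z' = "of_real r' * u"
  have lo: "(\<lambda>v. c * p v) \<preceq> (\<lambda>v. p (X ?z 0 v))" "(\<lambda>v. c * p v) \<preceq> (\<lambda>v. p (X ?z' 0 v))"
    using lower[of ?z] lower[of ?z'] r 0 by (auto simp: X_def S_0 norm_mult)
  have "(\<lambda>v. c * (c * p v)) \<preceq> (\<lambda>v. c * p (X ?z' 0 v))"
    using dom_mult[OF lo(2)] c by simp
  also have "\<dots> \<preceq> (\<lambda>v. p (X ?z 0 (X ?z' 0 v)))"
    using dom_adm[OF lo(1) adm_X[of ?z' 0]] .
  finally have "(\<lambda>v. ((r' - r) * K / c\<^sup>2) * (c * (c * p v)))
      \<preceq> (\<lambda>v. ((r' - r) * K / c\<^sup>2) * p (X ?z 0 (X ?z' 0 v)))"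
    by (rule dom_mult) (use r K_pos in auto)
  then have *: "(\<lambda>v. (r' - r) * (K * p v))
      \<preceq> (\<lambda>v. ((r' - r) * K / c\<^sup>2) * p (X ?z 0 (X ?z' 0 v)))"
    unfolding eq .
  have "(\<lambda>v. (r' - r) * p (B v)) \<preceq> (\<lambda>v. (r' - r) * (K * p v))"
    using r by (intro domI mult_left_mono B_bound) auto
  then show ?case using dom_trans[OF _ *] by (simp add: S_0)
next
  case (Suc k)
  \<comment> \<open>A square root of \<open>u\<close> yields points \<open>b\<close>,
    \<open>b'\<close> at level \<open>k\<close> whose squares are the points at level
    \<open>k + 1\<close>. Both roots \<open>s\<close> and \<open>- s\<close> have modulus 1, so the
    induction hypothesis applies to each.\<close>
  define s where "s = csqrt u"
  have s: "s * s = u" "cmod s = 1" "cmod (- s) = 1"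
    using Suc.prems by (simp_all add: s_def flip: power2_eq_square)
  define N where "N = (2::nat) ^ k"
  define T where "T = (r' - r) * K / c\<^sup>2"
  define b b' where "b = of_real r ^ N * s" and "b' = of_real r' ^ N * s"
  have bb: "b * b = of_real r ^ 2 ^ Suc k * u" "b' * b' = of_real r' ^ 2 ^ Suc k * u"
    by (simp_all add: b_def b'_def N_def power_two_power_Suc mult_ac flip: s(1) del: power_Suc)
  let ?v1 = "\<lambda>v. X (- b) k (X (- b') k v)" and ?v2 = "\<lambda>v. X b k (X b' k v)"
  let ?R = "\<lambda>v. p (X (b * b) (Suc k) (X (b' * b') (Suc k) v))"
  define d where "d = r' ^ N - r ^ N"
  have d: "d \<ge> 0" using r by (simp add: d_def power_mono)
  have 1: "(\<lambda>v. d * p (S k (?v1 v))) \<preceq> (\<lambda>v. T * ?R v)"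
    using dom_adm[OF Suc.IH[OF s(2)] adm_comp[OF adm_X[of "- b" k] adm_X[of "- b'" k]]]
    by (simp add: X_product d_def T_def flip: N_def b_def b'_def)
  have 2: "(\<lambda>v. d * p (S k (?v2 v))) \<preceq> (\<lambda>v. T * ?R v)"
    using dom_adm[OF Suc.IH[OF s(3)] adm_comp[OF adm_X[of b k] adm_X[of b' k]]]
    by (simp add: X_product d_def T_def flip: N_def b_def b'_def)
  have "2 * ((r' ^ 2 ^ Suc k - r ^ 2 ^ Suc k) * p (S (Suc k) v))
      \<le> d * p (S k (?v1 v)) + d * p (S k (?v2 v))" for v
  proof -
    \<comment> \<open>\<open>b\<close> and \<open>b'\<close> point in the same direction, so their
      moduli add; multiplied by \<open>d\<close> this gives the difference of the squares of
      \<open>r' ^ N\<close> and \<open>r ^ N\<close>.\<close>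
    have "cmod (b + b') = r' ^ N + r ^ N"
      using r s by (simp add: b_def b'_def norm_mult flip: distrib_right of_real_add of_real_power)
    then have "cmod ((b + b') + (b + b')) = 2 * (r' ^ N + r ^ N)"
      unfolding mult_2[symmetric] norm_mult by simp
    then have "d * p (((b + b') + (b + b')) *\<^sub>C S (Suc k) v) =
        d * (2 * (r' ^ N + r ^ N)) * p (S (Suc k) v)"
      by (simp only: p_scaleC_eq mult.assoc)
    also have "d * (2 * (r' ^ N + r ^ N)) = 2 * (r' ^ 2 ^ Suc k - r ^ 2 ^ Suc k)"
      by (simp add: d_def N_def power_two_power_Suc algebra_simps del: power_Suc)
    finally show ?thesis
      using mult_left_mono[OF p_diff[of "S k (?v1 v)" "S k (?v2 v)"] d]
      by (simp add: X_difference algebra_simps)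
  qed
  then have "(\<lambda>v. 2 * ((r' ^ 2 ^ Suc k - r ^ 2 ^ Suc k) * p (S (Suc k) v))) \<preceq>
      (\<lambda>v. d * p (S k (?v1 v)) + d * p (S k (?v2 v)))"
    by (rule domI)
  also have "\<dots> \<preceq> (\<lambda>v. T * ?R v + T * ?R v)"
    using dom_add[OF 1 2] .
  finally have "(\<lambda>v. (1/2) * (2 * ((r' ^ 2 ^ Suc k - r ^ 2 ^ Suc k) * p (S (Suc k) v)))) \<preceq>
      (\<lambda>v. (1/2) * (T * ?R v + T * ?R v))"
    by (rule dom_mult) simp
  then show ?case by (simp add: bb flip: T_def)
qed

section \<open>Decay of the dyadic powers\<close>

text \<open>The factor 1/2 survives squaring, since 1/4 is at most 1/2, and it is what finally
  clashes with a lower bound \<open>c ^ 2 ^ k\<close>.\<close>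

definition decay :: "real \<Rightarrow> nat \<Rightarrow> bool"
  where "decay r k \<longleftrightarrow> (\<lambda>v. p (S k v)) \<preceq> (\<lambda>v. (r ^ 2 ^ k / 2) * p v)"

lemma decay_mono:
  assumes "decay r k" "r > 0" "k \<le> m" shows "decay r m"
proof -
  have "decay r (Suc m)" if "decay r m" for m
  proof -
    let ?q = "r ^ 2 ^ m / 2"
    have q: "(\<lambda>v. p (S m v)) \<preceq> (\<lambda>v. ?q * p v)" using that by (simp add: decay_def)
    have "(\<lambda>v. p (S (Suc m) v)) \<preceq> (\<lambda>v. ?q * p (S m v))"
      using dom_adm[OF q adm_S[of m]] by (simp add: S_Suc)
    also have "\<dots> \<preceq> (\<lambda>v. ?q * (?q * p v))"
      using dom_mult[OF q, of ?q] \<open>r > 0\<close> by simp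
    also have "\<dots> \<preceq> (\<lambda>v. (r ^ 2 ^ Suc m / 2) * p v)"
      using p_nonneg \<open>r > 0\<close> by (intro domI) (simp add: power_two_power_Suc mult.assoc mult_nonneg_nonneg del: power_Suc)
    finally show ?thesis by (simp add: decay_def)
  qed
  then show ?thesis using dec_induct[OF \<open>k \<le> m\<close>, of "decay r"] assms(1) by blast
qed

text \<open>The resolvent averages at \<open>r\<close> and \<open>r'\<close> differ little, uniformly in
  the power \<open>2 ^ k\<close>, so the bound descends from \<open>r'\<close> to \<open>r\<close> in steps of fixed size, past the point where
  it contradicts the lower bound on \<open>B\<close>.\<close>

lemma decay_step:
  assumes r: "0 < r" "r < r'" "r' \<le> R" and c: "c > 0"
    and lower: "\<And>z. cmod z \<le> R \<Longrightarrow> (\<lambda>v. c * p v) \<preceq> (\<lambda>v. p (z *\<^sub>C v - B v))"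
    and small: "(r' - r) * K / c\<^sup>2 \<le> 1 / 12"
    and decay: "decay r' k"
  shows "\<exists>m. decay r m"
proof -
  obtain j where j: "(r / r') ^ j < 1 / 2"
    using real_arch_pow_inv[of "1/2" "r / r'"] r by auto
  \<comment> \<open>\<open>m\<close> is so large that decay at \<open>r'\<close> still holds and
    \<open>(r / r') ^ 2 ^ m \<le> 1 / 2\<close>, which makes \<open>r' ^ N - r ^ N\<close> at least
    half of \<open>r' ^ N\<close>.\<close>
  define m where "m = max k j"
  define N where "N = (2::nat) ^ m"
  have dm: "decay r' m" using decay_mono[OF decay] r by (simp add: m_def)
  have "j \<le> N" unfolding m_def N_def
    by (meson le_trans less_exp less_imp_le max.cobounded2)
  then have "(r / r') ^ N \<le> (r / r') ^ j"
    using r by (intro power_decreasing) auto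
  then have "r ^ N / r' ^ N \<le> 1 / 2"
    using j unfolding power_divide by linarith
  moreover have pos: "r' ^ N > 0" "r ^ N > 0" using r by simp_all
  ultimately have rN: "2 * r ^ N \<le> r' ^ N"
    unfolding pos_divide_le_eq[OF pos(1)] by linarith
  define T where "T = (r' - r) * K / c\<^sup>2"
  have T: "0 \<le> T" "T \<le> 1 / 12" using small r K_pos unfolding T_def by auto
  let ?a = "of_real r ^ N :: complex" and ?a' = "of_real r' ^ N :: complex"
  have comm: "X ?a m (X ?a' m v) = X ?a' m (X ?a m v)" for v
    by (simp add: expand algebra_simps)
  have upper: "p (X ?a m v) \<le> r ^ N * p v + p (S m v)" for v
    using p_diff[of "?a *\<^sub>C v" "S m v"] p_scaleC[of ?a v] r by (simp add: X_def norm_power)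
  have upper': "p (X ?a' m v) \<le> r' ^ N * p v + p (S m v)" for v
    using p_diff[of "?a' *\<^sub>C v" "S m v"] p_scaleC[of ?a' v] r by (simp add: X_def norm_power)
  have up2: "(\<lambda>v. p (X ?a' m v)) \<preceq> (\<lambda>v. 2 * r' ^ N * p v)"
  proof -
    have "(\<lambda>v. p (X ?a' m v)) \<preceq> (\<lambda>v. r' ^ N * p v + p (S m v))"
      using upper' by (rule domI)
    also have "\<dots> \<preceq> (\<lambda>v. r' ^ N * p v + (r' ^ N / 2) * p v)"
      using dm by (intro dom_add[OF domI]) (auto simp: decay_def N_def)
    also have "\<dots> \<preceq> (\<lambda>v. 2 * r' ^ N * p v)"
      using p_nonneg pos by (intro domI) (simp add: field_simps)
    finally show ?thesis .
  qed
  \<comment> \<open>The bound 1/12 is chosen so that \<open>p (S m v)\<close> reappears on the right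
    with weight 1/6 against 1/2 on the left. Absorbing it leaves exactly the coefficient
    \<open>r ^ N / 2\<close> of decay at \<open>r\<close>.\<close>
  have "(\<lambda>v. (r' ^ N / 2) * p (S m v)) \<preceq> (\<lambda>v. (r' ^ N - r ^ N) * p (S m v))"
    using p_nonneg rN by (intro domI mult_right_mono) auto
  also have "\<dots> \<preceq> (\<lambda>v. T * p (X ?a m (X ?a' m v)))"
    using dyadic_power_bound[OF r c lower, of 1 m] by (simp add: T_def N_def)
  also have "\<dots> \<preceq> (\<lambda>v. T * (2 * r' ^ N * p (X ?a m v)))"
    using dom_mult[OF dom_adm[OF up2 adm_X[of ?a m]] T(1)] by (simp add: comm)
  also have "\<dots> \<preceq> (\<lambda>v. (r' ^ N / 6) * (r ^ N * p v + p (S m v)))"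
  proof (rule domI)
    fix v
    have "T * (2 * r' ^ N * p (X ?a m v)) \<le> (1 / 12) * (2 * r' ^ N * p (X ?a m v))"
      using T pos p_nonneg by (intro mult_right_mono) auto
    also have "\<dots> = (r' ^ N / 6) * p (X ?a m v)" by simp
    also have "\<dots> \<le> (r' ^ N / 6) * (r ^ N * p v + p (S m v))"
      using pos upper by (intro mult_left_mono) auto
    finally show "T * (2 * r' ^ N * p (X ?a m v)) \<le> (r' ^ N / 6) * (r ^ N * p v + p (S m v))" .
  qed
  finally have "(\<lambda>v. (3 / r' ^ N) * ((r' ^ N / 2) * p (S m v))) \<preceq>
      (\<lambda>v. (3 / r' ^ N) * ((r' ^ N / 6) * (r ^ N * p v + p (S m v))))"
    by (rule dom_mult) (use pos in auto)
  then obtain C where "C \<ge> 0" and C: "\<And>v. (3 / r' ^ N) * ((r' ^ N / 2) * p (S m v))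
      \<le> (3 / r' ^ N) * ((r' ^ N / 6) * (r ^ N * p v + p (S m v))) + C * p (G v)"
    unfolding dom_def by blast
  have cancel: "(3 / q) * ((q / 2) * x) = 3 * x / 2" "(3 / q) * ((q / 6) * x) = x / 2"
    if "q > 0" for q x :: real
    using that by simp_all
  have "p (S m v) \<le> (r ^ N / 2) * p v + C * p (G v)" for v
    using C[of v] unfolding cancel[OF pos(1)] by (simp add: field_simps)
  then show ?thesis using \<open>C \<ge> 0\<close> unfolding decay_def dom_def N_def by blast
qed

text \<open>Iterating the lower bound \<open>2 ^ k\<close> times gives at least
  \<open>c ^ 2 ^ k\<close>, while decay allows only half of that because \<open>r \<le> c\<close>.
  Hence \<open>p v\<close> is at most a multiple of \<open>p (G v)\<close>.\<close>

lemma decay_small_imp_trivial: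
  assumes c: "c > 0" and lower: "(\<lambda>v. c * p v) \<preceq> (\<lambda>v. p (B v))"
    and r: "0 < r" "r \<le> c" and decay: "decay r k"
  shows "p \<preceq> (\<lambda>v. 0)"
proof -
  have "(\<lambda>v. c ^ n * p v) \<preceq> (\<lambda>v. p ((B ^^ n) v))" for n
  proof (induction n)
    case 0
    show ?case by (rule domI) simp
  next
    case (Suc n)
    have "(\<lambda>v. c * (c ^ n * p v)) \<preceq> (\<lambda>v. c ^ n * p (B v))"
      using dom_mult[OF lower, of "c ^ n"] c by (simp add: mult_ac)
    also have "\<dots> \<preceq> (\<lambda>v. p ((B ^^ n) (B v)))"
      using dom_adm[OF Suc adm_B] .
    finally show ?case by (simp add: funpow_swap1 mult.assoc)
  qed
  then have "(\<lambda>v. c ^ 2 ^ k * p v) \<preceq> (\<lambda>v. p (S k v))" by (simp add: S_def)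
  also have "\<dots> \<preceq> (\<lambda>v. (r ^ 2 ^ k / 2) * p v)" using decay by (simp add: decay_def)
  also have "\<dots> \<preceq> (\<lambda>v. (c ^ 2 ^ k / 2) * p v)"
    using p_nonneg r by (intro domI mult_right_mono divide_right_mono power_mono) auto
  finally obtain C where C: "C \<ge> 0" "\<And>v. c ^ 2 ^ k * p v \<le> (c ^ 2 ^ k / 2) * p v + C * p (G v)"
    unfolding dom_def by blast
  have "p v \<le> 0 + (2 * C / c ^ 2 ^ k) * p (G v)" for v
    using C(2)[of v] c by (simp add: field_simps)
  then show ?thesis unfolding dom_def using C(1) c by (intro exI[of _ "2 * C / c ^ 2 ^ k"]) auto
qed

text \<open>Moving \<open>z\<close> by less than half its bound keeps half of the bound, so finitely
  many balls covering the closed disc give a common \<open>c\<close>. The error constants hidden in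
  the relation may still vary with \<open>z\<close>.\<close>

lemma uniform_lower_bound:
  assumes "\<And>z. \<exists>c>0. (\<lambda>v. c * p v) \<preceq> (\<lambda>v. p (z *\<^sub>C v - B v))"
  shows "\<exists>c>0. \<forall>z. cmod z \<le> R \<longrightarrow> (\<lambda>v. c * p v) \<preceq> (\<lambda>v. p (z *\<^sub>C v - B v))"
proof -
  obtain c where c: "\<And>z. c z > 0" "\<And>z. (\<lambda>v. c z * p v) \<preceq> (\<lambda>v. p (z *\<^sub>C v - B v))"
    using assms by metis
  have "cball 0 R \<subseteq> (\<Union>z. ball z (c z / 2))"
  proof
    fix z :: complex
    have "z \<in> ball z (c z / 2)" using c(1)[of z] by simp
    then show "z \<in> (\<Union>z. ball z (c z / 2))" by blast
  qed
  then obtain Z where Z: "finite Z" "cball (0::complex) R \<subseteq> (\<Union>z\<in>Z. ball z (c z / 2))"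
    by (rule compactE_image[OF compact_cball, rotated]) auto
  define d where "d = Min (insert 1 ((\<lambda>z. c z / 2) ` Z))"
  have d: "d > 0" "\<And>z. z \<in> Z \<Longrightarrow> d \<le> c z / 2"
    using Z(1) c(1) unfolding d_def by (simp, intro Min_le) auto
  have "(\<lambda>v. d * p v) \<preceq> (\<lambda>v. p (z *\<^sub>C v - B v))" if z: "cmod z \<le> R" for z
  proof -
    have "z \<in> (\<Union>z\<in>Z. ball z (c z / 2))" using z by (intro subsetD[OF Z(2)]) simp
    then obtain y where y: "y \<in> Z" "dist y z < c y / 2" by auto
    obtain C where C: "C \<ge> 0" "\<And>v. c y * p v \<le> p (y *\<^sub>C v - B v) + C * p (G v)"
      using c(2)[of y] unfolding dom_def by blast
    have "d * p v \<le> p (z *\<^sub>C v - B v) + C * p (G v)" for v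
    proof -
      have eq: "y *\<^sub>C v - B v = (z *\<^sub>C v - B v) + (y - z) *\<^sub>C v"
        by (simp add: scaleC_algebra)
      have "p (y *\<^sub>C v - B v) \<le> p (z *\<^sub>C v - B v) + cmod (y - z) * p v"
        unfolding eq using p_add[of "z *\<^sub>C v - B v" "(y - z) *\<^sub>C v"] p_scaleC[of "y - z" v]
        by linarith
      moreover have "cmod (y - z) * p v \<le> (c y - d) * p v"
        using y d(2)[OF y(1)] p_nonneg by (intro mult_right_mono) (auto simp: dist_norm)
      ultimately show ?thesis using C(2)[of v] by (simp add: left_diff_distrib)
    qed
    then show ?thesis using C(1) unfolding dom_def by blast
  qed
  then show ?thesis using d(1) by blast
qed

text \<open>Without such a \<open>z\<close>, \<open>B\<close> would satisfy uniform lower bounds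
  modulo \<open>G\<close> for \<open>z\<close> in the disc of radius \<open>2 * K\<close>. Decay,
  which holds at \<open>2 * K\<close>, could then be carried in steps of length \<open>h\<close> to
  a radius at most \<open>c\<close>, and \<open>p v\<close> would be controlled by
  \<open>p (G v)\<close>.\<close>

theorem joint_approximate_eigenvalue:
  assumes "\<not> (\<exists>C. \<forall>v. p v \<le> C * p (G v))"
  shows "\<exists>z. \<forall>c>0. \<forall>C\<ge>0. \<exists>v. p (z *\<^sub>C v - B v) + C * p (G v) < c * p v"
proof (rule ccontr)
  assume neg: "\<not> ?thesis"
  have "\<exists>c>0. (\<lambda>v. c * p v) \<preceq> (\<lambda>v. p (z *\<^sub>C v - B v))" for z
    using neg unfolding dom_def by (meson not_less)
  from uniform_lower_bound[OF this, of "2 * K"] obtain c where c: "c > 0"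
    and lower: "\<And>z. cmod z \<le> 2 * K \<Longrightarrow> (\<lambda>v. c * p v) \<preceq> (\<lambda>v. p (z *\<^sub>C v - B v))"
    by blast
  \<comment> \<open>The bound by \<open>c\<close> lets the last radius reach \<open>c\<close> or
    less; the other one makes each step meet the constant 1/12.\<close>
  define h where "h = min c (c\<^sup>2 / (12 * K))"
  have h: "h > 0" "h \<le> c" "h * K / c\<^sup>2 \<le> 1 / 12"
    using c K_pos by (auto simp: h_def min_def field_simps)
  have "\<exists>k. decay (2 * K - real n * h) k" if "2 * K - real n * h > 0" for n
    using that
  proof (induction n)
    case 0
    \<comment> \<open>At level 0 decay reads \<open>p (B v) \<le> (2 * K / 2) * p v\<close>, the
      reason for starting at \<open>2 * K\<close>.\<close>
    have "decay (2 * K) 0"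
      unfolding decay_def S_0 by (rule domI) (use B_bound in auto)
    then show ?case by auto
  next
    case (Suc n)
    have lt: "2 * K - real (Suc n) * h < 2 * K - real n * h" using h by (simp add: algebra_simps)
    then obtain k where k: "decay (2 * K - real n * h) k" using Suc by auto
    show ?case
      by (rule decay_step[OF Suc.prems lt _ c lower _ k]) (use h in \<open>auto simp: algebra_simps\<close>)
  qed
  \<comment> \<open>The largest number of steps that leaves a positive radius, which is then at most
    \<open>h\<close>. The ceiling minus 1 keeps the inequality strict when \<open>2 * K / h\<close>
    is an integer.\<close>
  moreover define n where "n = nat (\<lceil>2 * K / h\<rceil> - 1)"
  have "2 * K / h > 0" using K_pos h by simp
  then have "real n < 2 * K / h" "2 * K / h \<le> real n + 1"
    unfolding n_def by linarith+
  then have r: "2 * K - real n * h > 0" "2 * K - real n * h \<le> h"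
    using h by (auto simp: field_simps)
  ultimately obtain k where "decay (2 * K - real n * h) k" by blast
  moreover have "(\<lambda>v. c * p v) \<preceq> (\<lambda>v. p (B v))"
    using lower[of 0] K_pos p_scaleC_eq[of "-1"] by simp
  ultimately have "p \<preceq> (\<lambda>v. 0)"
    using decay_small_imp_trivial[OF c _ r(1)] r(2) h(2) by auto
  then show False using assms unfolding dom_def by auto
qed

end

section \<open>The semigroup and its derivatives\<close>

lemma right_difference_quotient:
  fixes f :: "real \<Rightarrow> 'a::real_normed_vector"
  assumes "(f has_vector_derivative f') (at_right t)"
  shows "((\<lambda>h. (f (t + h) - f t) /\<^sub>R h) \<longlongrightarrow> f') (at_right 0)"
proof -
  have "((\<lambda>y. (f y - (f t + (y - t) *\<^sub>R f')) /\<^sub>R norm (y - t)) \<longlongrightarrow> 0) (at_right t)"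
    using assms by (simp add: has_vector_derivative_def has_derivative_within divide_inverse_commute)
  then have "((\<lambda>h. (f (t + h) - (f t + h *\<^sub>R f')) /\<^sub>R norm h) \<longlongrightarrow> 0) (at_right 0)"
    by (subst (asm) filterlim_at_right_to_0) (simp add: add.commute)
  moreover have "\<forall>\<^sub>F h in at_right 0. (f (t + h) - (f t + h *\<^sub>R f')) /\<^sub>R norm h =
      (f (t + h) - f t) /\<^sub>R h - f'"
    using eventually_at_right_less[of 0] by eventually_elim (simp add: algebra_simps)
  ultimately have "((\<lambda>h. (f (t + h) - f t) /\<^sub>R h - f') \<longlongrightarrow> 0) (at_right 0)"
    by (rule Lim_transform_eventually)
  then show ?thesis by (rule LIM_zero_cancel)
qed

lemma integral_right_difference_quotient:
  fixes g :: "real \<Rightarrow> 'a::banach"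
  assumes "continuous_on {0..} g" "t \<ge> 0"
  shows "((\<lambda>h. integral {t..t + h} g /\<^sub>R h) \<longlongrightarrow> g t) (at_right 0)"
proof -
  have "((\<lambda>u. integral {t..u} g) has_vector_derivative g t) (at t within {t..t + 1})"
    by (rule integral_has_vector_derivative)
      (use assms in \<open>auto intro: continuous_on_subset\<close>)
  then have "((\<lambda>u. integral {t..u} g) has_vector_derivative g t) (at_right t)"
    by (simp add: at_within_Icc_at_right)
  from right_difference_quotient[OF this] show ?thesis by simp
qed

lemma generatorI:
  assumes "((\<lambda>h. (T h x - x) /\<^sub>R h) \<longlongrightarrow> y) (at_right 0)"
  shows "x \<in> generator_domain T" "generator T x = y"
  using assms by (auto simp: generator_domain_def generator_def intro: tendsto_Lim)

lemma generatorD: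
  assumes "x \<in> generator_domain T"
  shows "((\<lambda>h. (T h x - x) /\<^sub>R h) \<longlongrightarrow> generator T x) (at_right 0)"
  using assms generatorI(2)[of T x] by (auto simp: generator_domain_def)

lemma generator_add:
  assumes "C0_semigroup T" "x \<in> generator_domain T" "y \<in> generator_domain T"
  shows "x + y \<in> generator_domain T" "generator T (x + y) = generator T x + generator T y"
proof -
  have "\<forall>\<^sub>F h in at_right 0. (T h x - x) /\<^sub>R h + (T h y - y) /\<^sub>R h = (T h (x + y) - (x + y)) /\<^sub>R h"
    using eventually_at_right_less[of 0]
  proof eventually_elim
    case (elim h)
    then have "bounded_clinear (T h)" using assms by (auto simp: C0_semigroup_def)
    then show ?case by (simp add: bounded_clinearD algebra_simps)
  qed
  with tendsto_add[OF generatorD[OF assms(2)] generatorD[OF assms(3)]]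
  have "((\<lambda>h. (T h (x + y) - (x + y)) /\<^sub>R h) \<longlongrightarrow> generator T x + generator T y) (at_right 0)"
    by (rule Lim_transform_eventually)
  then show "x + y \<in> generator_domain T" "generator T (x + y) = generator T x + generator T y"
    by (rule generatorI)+
qed

lemma generator_commute:
  assumes "bounded_linear L" "\<And>h x. h > 0 \<Longrightarrow> L (T h x) = T h (L x)" "x \<in> generator_domain T"
  shows "L x \<in> generator_domain T" "generator T (L x) = L (generator T x)"
proof -
  note lin = bounded_linear.linear[OF assms(1)]
  have "\<forall>\<^sub>F h in at_right 0. L ((T h x - x) /\<^sub>R h) = (T h (L x) - L x) /\<^sub>R h"
    using eventually_at_right_less[of 0]
    by eventually_elim (simp add: assms(2) linear_scale[OF lin] linear_diff[OF lin])
  with bounded_linear.tendsto[OF assms(1) generatorD[OF assms(3)]]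
  have "((\<lambda>h. (T h (L x) - L x) /\<^sub>R h) \<longlongrightarrow> L (generator T x)) (at_right 0)"
    by (rule Lim_transform_eventually)
  then show "L x \<in> generator_domain T" "generator T (L x) = L (generator T x)"
    by (rule generatorI)+
qed

locale differentiable_C0_semigroup =
  fixes T :: "real \<Rightarrow> 'a::complex_banach \<Rightarrow> 'a"
  assumes differentiable: "differentiable_semigroup T"
begin

abbreviation "D \<equiv> semigroup_deriv T"
abbreviation "A \<equiv> generator T"
abbreviation "dom_A \<equiv> generator_domain T"

lemma C0: "C0_semigroup T"
  using differentiable by (simp add: differentiable_semigroup_def)

lemma T_bounded: "t \<ge> 0 \<Longrightarrow> bounded_clinear (T t)"
  and T_0: "T 0 x = x"
  and T_add: "s \<ge> 0 \<Longrightarrow> t \<ge> 0 \<Longrightarrow> T (s + t) x = T s (T t x)"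
  and T_at_0: "((\<lambda>t. T t x) \<longlongrightarrow> x) (at_right 0)"
  using C0 by (auto simp: C0_semigroup_def)

lemma T_commute: "s \<ge> 0 \<Longrightarrow> t \<ge> 0 \<Longrightarrow> T s (T t x) = T t (T s x)"
  by (metis T_add add.commute)

lemma T_continuous: "continuous_on {0..} (\<lambda>t. T t x)"
  unfolding continuous_on_def
proof
  fix t :: real
  assume "t \<in> {0..}"
  show "((\<lambda>t. T t x) \<longlongrightarrow> T t x) (at t within {0..})"
  proof (cases "t = 0")
    case True
    then show ?thesis using T_at_0 by (simp add: T_0 at_within_Ici_at_right)
  next
    case False
    then have "(\<lambda>t. T t x) differentiable (at t)"
      using differentiable \<open>t \<in> {0..}\<close> by (simp add: differentiable_semigroup_def)
    then have "isCont (\<lambda>t. T t x) t" by (rule differentiable_imp_continuous_within)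
    then show ?thesis using isContD tendsto_within_subset by blast
  qed
qed

text \<open>The four facts feed one another in the induction. Near \<open>t\<close> the next
  derivative is the orbit \<open>T (\<tau> - t / 2)\<close> of the vector
  \<open>D (Suc n) (t / 2) x\<close>, and every orbit is differentiable at positive times.
  Boundedness comes from pointwise limits of difference quotients.\<close>

lemma D_facts:
  assumes "t > 0"
  shows "((\<lambda>s. D n s x) has_vector_derivative D (Suc n) t x) (at t)"
    and "s \<ge> 0 \<Longrightarrow> D n (t + s) x = T s (D n t x)"
    and "s \<ge> 0 \<Longrightarrow> D n t (T s x) = T s (D n t x)"
    and "bounded_clinear (D n t)"
  using assms
proof (induction n arbitrary: t x s)
  case 0
  {
    case 1
    then show ?case
      using differentiable by (simp add: differentiable_semigroup_def flip: vector_derivative_works)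
  }
  {
    case 2
    then show ?case using T_add[of s t x] by (simp add: add.commute)
  }
  {
    case 3
    then show ?case by (simp add: T_commute)
  }
  {
    case 4
    then show ?case using T_bounded[of t] by simp
  }
next
  case (Suc n)
  note deriv = Suc(1) and shift = Suc(2) and comm = Suc(3) and bdd = Suc(4)
  have T_D: "((\<lambda>\<tau>. T s (D n \<tau> x)) has_vector_derivative T s (D (Suc n) t x)) (at t)"
    if "t > 0" "s \<ge> 0" for t s x
    using bounded_linear.has_vector_derivative[OF bounded_clinearD(1)[OF T_bounded[OF that(2)]]
        deriv[OF that(1)]] .
  have shift': "D (Suc n) (t + s) x = T s (D (Suc n) t x)" if "t > 0" "s \<ge> 0" for t s x
  proof -
    have "((\<lambda>\<tau>. D n \<tau> x) \<circ> (\<lambda>\<tau>. \<tau> + s) has_vector_derivative 1 *\<^sub>R D (Suc n) (t + s) x) (at t)"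
      by (rule vector_diff_chain_at)
        (use that deriv[of "t + s" x] in \<open>auto intro!: derivative_eq_intros\<close>)
    moreover have "((\<lambda>\<tau>. D n \<tau> x) \<circ> (\<lambda>\<tau>. \<tau> + s) has_vector_derivative T s (D (Suc n) t x)) (at t)"
      by (rule has_vector_derivative_transform_within_open[OF T_D[OF that], of "{0<..}"])
        (use that shift in auto)
    ultimately show ?thesis using vector_derivative_unique_at by fastforce
  qed
  have comm': "D (Suc n) t (T s x) = T s (D (Suc n) t x)" if "t > 0" "s \<ge> 0" for t s x
  proof -
    have "((\<lambda>\<tau>. D n \<tau> (T s x)) has_vector_derivative T s (D (Suc n) t x)) (at t)"
      by (rule has_vector_derivative_transform_within_open[OF T_D[OF that], of "{0<..}"])
        (use that comm in auto)
    then show ?thesis using vector_derivative_unique_at deriv[OF that(1)] by blast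
  qed
  {
    case 1
    have "(\<lambda>\<tau>. T \<tau> (D (Suc n) (t / 2) x)) differentiable at (t / 2)"
      using differentiable 1 by (simp add: differentiable_semigroup_def)
    then have "((\<lambda>\<tau>. T \<tau> (D (Suc n) (t / 2) x)) has_vector_derivative
        vector_derivative (\<lambda>\<tau>. T \<tau> (D (Suc n) (t / 2) x)) (at (t / 2))) (at (t - t / 2))"
      by (simp add: vector_derivative_works)
    then have "((\<lambda>\<tau>. T \<tau> (D (Suc n) (t / 2) x)) \<circ> (\<lambda>\<tau>. \<tau> - t / 2) has_vector_derivative
        1 *\<^sub>R vector_derivative (\<lambda>\<tau>. T \<tau> (D (Suc n) (t / 2) x)) (at (t / 2))) (at t)"
      by (intro vector_diff_chain_at) (auto intro!: derivative_eq_intros)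
    then have "((\<lambda>\<tau>. D (Suc n) \<tau> x) has_vector_derivative
        1 *\<^sub>R vector_derivative (\<lambda>\<tau>. T \<tau> (D (Suc n) (t / 2) x)) (at (t / 2))) (at t)"
    proof (rule has_vector_derivative_transform_within_open[of _ _ _ "{t / 2<..}"])
      fix \<tau> assume "\<tau> \<in> {t / 2<..}"
      then show "((\<lambda>\<tau>. T \<tau> (D (Suc n) (t / 2) x)) \<circ> (\<lambda>\<tau>. \<tau> - t / 2)) \<tau> = D (Suc n) \<tau> x"
        using shift'[of "t / 2" "\<tau> - t / 2" x] 1 by (simp del: semigroup_deriv.simps)
    qed (use 1 in auto)
    then show ?case
      using vector_derivative_works differentiableI_vector semigroup_deriv.simps(2) by metis
  }
  {
    case 2
    then show ?case using shift' by blast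
  }
  {
    case 3
    then show ?case using comm' by blast
  }
  {
    case 4
    let ?h = "\<lambda>k. inverse (real (Suc k))"
    show ?case
    proof (rule bounded_clinear_pointwise_limit)
      fix k
      show "bounded_clinear (\<lambda>x. complex_of_real (inverse (?h k)) *\<^sub>C (D n (t + ?h k) x - D n t x))"
        using 4 by (intro bounded_clinear_scaleC_compose bounded_clinear_diff bdd)
          (auto intro: add_pos_nonneg)
    next
      fix x
      have "((\<lambda>h. (D n (t + h) x - D n t x) /\<^sub>R h) \<longlongrightarrow> D (Suc n) t x) (at_right 0)"
        by (rule right_difference_quotient[OF has_vector_derivative_at_within[OF deriv[OF 4]]])
      moreover have "filterlim ?h (at_right 0) sequentially"
        unfolding filterlim_at using LIMSEQ_inverse_real_of_nat by simp
      ultimately have "(\<lambda>k. (D n (t + ?h k) x - D n t x) /\<^sub>R ?h k) \<longlonglongrightarrow> D (Suc n) t x"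
        by (rule filterlim_compose)
      then show "(\<lambda>k. complex_of_real (inverse (?h k)) *\<^sub>C (D n (t + ?h k) x - D n t x))
          \<longlonglongrightarrow> D (Suc n) t x"
        by (simp only: scaleC_of_real)
    qed
  }
qed

text \<open>By the shift law, the semigroup quotient at the vector \<open>D n t x\<close> is the
  quotient at time \<open>t\<close> of the map taking \<open>s\<close> to \<open>D n s x\<close>.
  Thus \<open>D n t\<close> is \<open>T t\<close> followed by \<open>n\<close> applications of
  \<open>A\<close>.\<close>

lemma A_D:
  assumes "t > 0"
  shows "D n t x \<in> dom_A" "A (D n t x) = D (Suc n) t x"
proof -
  have "((\<lambda>h. (D n (t + h) x - D n t x) /\<^sub>R h) \<longlongrightarrow> D (Suc n) t x) (at_right 0)"
    by (rule right_difference_quotient[OF has_vector_derivative_at_within[OF D_facts(1)[OF assms]]])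
  moreover have "\<forall>\<^sub>F h in at_right 0. (D n (t + h) x - D n t x) /\<^sub>R h = (T h (D n t x) - D n t x) /\<^sub>R h"
    using eventually_at_right_less[of 0] by eventually_elim (simp add: D_facts(2) assms)
  ultimately have "((\<lambda>h. (T h (D n t x) - D n t x) /\<^sub>R h) \<longlongrightarrow> D (Suc n) t x) (at_right 0)"
    by (rule Lim_transform_eventually)
  then show "D n t x \<in> dom_A" "A (D n t x) = D (Suc n) t x"
    by (rule generatorI)+
qed

lemma commute_D:
  assumes L: "bounded_linear L" "\<And>s x. s \<ge> 0 \<Longrightarrow> L (T s x) = T s (L x)" and "t > 0"
  shows "L (D n t x) = D n t (L x)"
  using \<open>t > 0\<close>
proof (induction n arbitrary: t)
  case 0
  then show ?case using L(2) by simp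
next
  case (Suc n)
  then show ?case
    using generator_commute(2)[OF L(1), of T "D n t x"] L(2) by (simp add: A_D del: semigroup_deriv.simps(2))
qed

text \<open>Since \<open>L\<close> commutes with the semigroup, \<open>(z - A) L = E\<close> implies \<open>L (z - A) = E\<close> on the
  domain of \<open>A\<close>.\<close>

definition factor :: "complex \<Rightarrow> ('a \<Rightarrow> 'a) \<Rightarrow> ('a \<Rightarrow> 'a) \<Rightarrow> bool"
  where "factor z L E \<longleftrightarrow> bounded_clinear L \<and> (\<forall>x. L x \<in> dom_A \<and> z *\<^sub>C L x - A (L x) = E x) \<and>
    (\<forall>s\<ge>0. \<forall>x. L (T s x) = T s (L x))"

lemma factor_generator:
  assumes "factor z L E" "x \<in> dom_A"
  shows "L (z *\<^sub>C x - A x) = E x"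
proof -
  have L: "bounded_clinear L" using assms by (simp add: factor_def)
  have "A (L x) = L (A x)"
    by (rule generator_commute) (use assms bounded_clinearD(1)[OF L] in \<open>auto simp: factor_def\<close>)
  moreover have "E x = z *\<^sub>C L x - A (L x)" using assms by (simp add: factor_def)
  ultimately show ?thesis by (simp add: bounded_clinearD(3,6)[OF L])
qed

lemma A_scaleC:
  assumes "x \<in> dom_A"
  shows "c *\<^sub>C x \<in> dom_A" "A (c *\<^sub>C x) = c *\<^sub>C A x"
  using generator_commute[OF bounded_linear_scaleC_right, of c T x] assms
    bounded_clinearD(6)[OF T_bounded] by auto

lemma factor_add:
  assumes "factor z L E" "factor z L' E'"
  shows "factor z (\<lambda>x. c *\<^sub>C L x + L' x) (\<lambda>x. c *\<^sub>C E x + E' x)"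
proof -
  have L: "bounded_clinear L" "bounded_clinear L'"
    "\<And>x. L x \<in> dom_A" "\<And>x. L' x \<in> dom_A" "\<And>x. E x = z *\<^sub>C L x - A (L x)"
    "\<And>x. E' x = z *\<^sub>C L' x - A (L' x)"
    "\<And>s x. s \<ge> 0 \<Longrightarrow> L (T s x) = T s (L x)" "\<And>s x. s \<ge> 0 \<Longrightarrow> L' (T s x) = T s (L' x)"
    using assms by (auto simp: factor_def)
  note dom = A_scaleC[OF L(3)] generator_add[OF C0 A_scaleC(1)[OF L(3)] L(4)]
  show ?thesis
    unfolding factor_def
  proof (intro conjI allI impI)
    show "bounded_clinear (\<lambda>x. c *\<^sub>C L x + L' x)"
      by (intro bounded_clinear_add bounded_clinear_scaleC_compose L)
  next
    fix x
    show "c *\<^sub>C L x + L' x \<in> dom_A" by (rule dom)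
    show "z *\<^sub>C (c *\<^sub>C L x + L' x) - A (c *\<^sub>C L x + L' x) = c *\<^sub>C E x + E' x"
      by (simp add: dom L(5,6) scaleC_algebra mult.commute)
  next
    fix s :: real and x
    assume "s \<ge> 0"
    then show "c *\<^sub>C L (T s x) + L' (T s x) = T s (c *\<^sub>C L x + L' x)"
      by (simp add: L(7,8) bounded_clinearD(2,6)[OF T_bounded])
  qed
qed

text \<open>Telescoping: \<open>z ^ Suc n - A ^ Suc n = z (z ^ n - A ^ n) + (z - A) A ^ n\<close>,
  applied after \<open>T t\<close>. The last term factors through \<open>D n t\<close>, whose range
  lies in the domain of \<open>A\<close>.\<close>

lemma factor_power:
  assumes "t > 0"
  shows "\<exists>L. factor z L (\<lambda>x. z ^ n *\<^sub>C T t x - D n t x)"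
proof (induction n)
  case 0
  have "((\<lambda>h. (T h 0 - 0) /\<^sub>R h) \<longlongrightarrow> 0) (at_right 0)"
    by (rule tendsto_eventually, rule eventually_at_rightI[of 0 1])
      (auto simp: bounded_clinearD(5)[OF T_bounded])
  note generatorI[of T, OF this]
  with bounded_clinearD(5)[OF T_bounded] have "factor z (\<lambda>x. 0) (\<lambda>x. z ^ 0 *\<^sub>C T t x - D 0 t x)"
    by (simp add: factor_def bounded_clinear_zero)
  then show ?case by (intro exI[of _ "\<lambda>x. 0"])
next
  case (Suc n)
  then obtain L where L: "factor z L (\<lambda>x. z ^ n *\<^sub>C T t x - D n t x)" ..
  have "factor z (D n t) (\<lambda>x. z *\<^sub>C D n t x - D (Suc n) t x)"
    using assms by (simp add: factor_def A_D D_facts(3,4) del: semigroup_deriv.simps)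
  from factor_add[OF L this, of z]
  have "factor z (\<lambda>x. z *\<^sub>C L x + D n t x) (\<lambda>x. z ^ Suc n *\<^sub>C T t x - D (Suc n) t x)"
    by (simp add: scaleC_algebra del: semigroup_deriv.simps)
  then show ?case by (intro exI[of _ "\<lambda>x. z *\<^sub>C L x + D n t x"])
qed

text \<open>\<open>U\<close> is the rescaled semigroup with generator \<open>A - z\<close>, and its
  generator maps the integral of an orbit over \<open>{0..t}\<close> to the difference of the end
  points.\<close>

lemma rescaled_integral:
  fixes z :: complex and t :: real
  defines "U \<equiv> \<lambda>(s :: real) x. exp (- z * of_real s) *\<^sub>C T s x"
  assumes "t \<ge> 0"
  shows "factor z (\<lambda>x. integral {0..t} (\<lambda>s. U s x)) (\<lambda>x. x - U t x)"
proof -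
  define W where "W = (\<lambda>x. integral {0..t} (\<lambda>s. U s x))"
  have U_bdd: "bounded_clinear (U s)" if "s \<ge> 0" for s
    unfolding U_def using that by (intro bounded_clinear_scaleC_compose T_bounded)
  have U_cont: "continuous_on {0..} (\<lambda>s. U s x)" for x
    unfolding U_def
    by (intro bounded_bilinear.continuous_on[OF bounded_bilinear_scaleC] T_continuous continuous_intros)
  have U_cont': "continuous_on {a..b} (\<lambda>s. U s x)" if "a \<ge> 0" for x a b
    using that by (auto intro: continuous_on_subset[OF U_cont])
  have U_int: "(\<lambda>s. U s x) integrable_on {a..b}" if "a \<ge> 0" for x a b
    using integrable_continuous_real[OF U_cont'[OF that]] .
  have U_add: "U (h + s) x = U h (U s x)" if "h \<ge> 0" "s \<ge> 0" for h s x
    using that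
    by (simp add: U_def T_add bounded_clinearD(6)[OF T_bounded] scaleC_scaleC distrib_left
        flip: exp_add)
  have W_apply: "L (W x) = integral {0..t} (\<lambda>s. L (U s x))" if "bounded_linear L" for L x
    using integral_linear[OF U_int[where a = 0 and b = t and x = x] that] by (simp add: W_def o_def)
  have W_bdd: "bounded_clinear W"
  proof -
    have "\<exists>K>0. \<forall>s\<in>{0..t}. \<forall>x. norm (U s x) \<le> K * norm x"
    proof (rule uniform_boundedness)
      fix x
      have "bounded ((\<lambda>s. U s x) ` {0..t})"
        using compact_continuous_image[OF U_cont'] compact_imp_bounded by blast
      then show "\<exists>M. \<forall>s\<in>{0..t}. norm (U s x) \<le> M" by (auto simp: bounded_iff)
    qed (use U_bdd bounded_clinearD(1) in auto)
    then obtain K where K: "K > 0" "\<And>s x. s \<in> {0..t} \<Longrightarrow> norm (U s x) \<le> K * norm x"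
      by blast
    have W_scaleC: "W (c *\<^sub>C x) = c *\<^sub>C W x" for c x
      unfolding W_apply[OF bounded_linear_scaleC_right] unfolding W_def
      by (rule integral_cong) (simp add: bounded_clinearD(6)[OF U_bdd])
    have W_add: "W (x + y) = W x + W y" for x y
      unfolding W_def
      by (subst integral_add[symmetric], (intro U_int order_refl)+, rule integral_cong)
        (simp add: bounded_clinearD(2)[OF U_bdd])
    have "norm (W x) \<le> norm x * (K * t)" for x
      using integral_bound[OF \<open>t \<ge> 0\<close> U_cont'[of 0 t x], of "K * norm x"] K
      by (simp add: W_def mult_ac)
    then show ?thesis
      unfolding bounded_clinear_def
      using W_add W_scaleC by (auto intro!: bounded_linear_intro simp flip: scaleC_of_real)
  qed
  have W_T: "W (T s x) = T s (W x)" if "s \<ge> 0" for s x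
    unfolding W_apply[OF bounded_clinearD(1)[OF T_bounded[OF that]]]
    unfolding W_def U_def
    by (rule integral_cong) (simp add: T_commute that bounded_clinearD(6)[OF T_bounded])
  have W_gen: "((\<lambda>h. (T h (W x) - W x) /\<^sub>R h) \<longlongrightarrow> (U t x - x) + z *\<^sub>C W x) (at_right 0)" for x
  proof -
    have U0: "U 0 x = x" by (simp add: U_def T_0)
    \<comment> \<open>Translation by \<open>h\<close> changes the integral only by the end pieces
      over \<open>{t..t + h}\<close> and \<open>{0..h}\<close>.\<close>
    have "((\<lambda>h. integral {t..t + h} (\<lambda>s. U s x) /\<^sub>R h - integral {0..0 + h} (\<lambda>s. U s x) /\<^sub>R h)
        \<longlongrightarrow> U t x - U 0 x) (at_right 0)"
      by (intro tendsto_diff integral_right_difference_quotient U_cont) (use \<open>t \<ge> 0\<close> in auto)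
    moreover have "integral {t..t + h} (\<lambda>s. U s x) - integral {0..h} (\<lambda>s. U s x) = U h (W x) - W x"
      if "h > 0" for h
    proof -
      have "U h (W x) = integral {0..t} ((\<lambda>s. U s x) \<circ> (+) h)"
        using that unfolding W_apply[OF bounded_clinearD(1)[OF U_bdd[OF less_imp_le[OF that]]]]
        by (intro integral_cong) (simp add: U_add)
      also have "\<dots> = integral {h..t + h} (\<lambda>s. U s x)"
        by (simp add: integral_shift_Icc_real)
      finally have "integral {0..h} (\<lambda>s. U s x) + U h (W x) = integral {0..t + h} (\<lambda>s. U s x)"
        using that \<open>t \<ge> 0\<close>
        by (simp add: Henstock_Kurzweil_Integration.integral_combine U_int)
      also have "\<dots> = W x + integral {t..t + h} (\<lambda>s. U s x)"
        using that \<open>t \<ge> 0\<close>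
        by (simp add: Henstock_Kurzweil_Integration.integral_combine U_int W_def)
      finally show ?thesis by (simp add: algebra_simps)
    qed
    ultimately have U_lim: "((\<lambda>h. (U h (W x) - W x) /\<^sub>R h) \<longlongrightarrow> U t x - x) (at_right 0)"
      by (rule_tac Lim_transform_eventually)
        (auto simp: U0 eventually_at_right_less scaleR_diff_right[symmetric]
          intro!: eventually_at_rightI[of 0 1])
    \<comment> \<open>Return from \<open>U\<close> to \<open>T\<close> by a product rule at 0: for
      \<open>w = W x\<close>, \<open>T h w - w\<close> is
      \<open>exp (z h) (U h w - w) + (exp (z h) - 1) w\<close>.\<close>
    have "((\<lambda>h. exp (z * of_real h)) has_vector_derivative z) (at_right 0)"
      by (auto intro!: derivative_eq_intros has_vector_derivative_real_field)
    from right_difference_quotient[OF this]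
    have e_lim: "((\<lambda>h. (exp (z * of_real h) - 1) /\<^sub>R h) \<longlongrightarrow> z) (at_right 0)" by simp
    have e_lim': "((\<lambda>h. exp (z * of_real h)) \<longlongrightarrow> exp (z * of_real 0)) (at_right 0)"
      by (intro tendsto_intros)
    have "((\<lambda>h. exp (z * of_real h) *\<^sub>C ((U h (W x) - W x) /\<^sub>R h) +
        ((exp (z * of_real h) - 1) /\<^sub>R h) *\<^sub>C W x) \<longlongrightarrow>
        exp (z * of_real 0) *\<^sub>C (U t x - x) + z *\<^sub>C W x) (at_right 0)"
      by (intro tendsto_add bounded_bilinear.tendsto[OF bounded_bilinear_scaleC] e_lim e_lim'
          U_lim tendsto_const)
    moreover have "exp (z * of_real h) *\<^sub>C ((U h (W x) - W x) /\<^sub>R h) +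
        ((exp (z * of_real h) - 1) /\<^sub>R h) *\<^sub>C W x = (T h (W x) - W x) /\<^sub>R h" for h
    proof -
      have cancel: "exp (z * of_real h) * (c * inverse (exp (z * of_real h))) = c" for c :: complex
        by simp
      show ?thesis
        unfolding U_def
        by (simp add: cancel scaleC_algebra scaleR_conv_of_real exp_minus right_diff_distrib mult.commute
            flip: scaleC_of_real)
    qed
    ultimately show ?thesis by simp
  qed
  have "W x \<in> dom_A" "z *\<^sub>C W x - A (W x) = x - U t x" for x
    using generatorI[of T, OF W_gen, of x] by (simp_all add: algebra_simps)
  then have "factor z W (\<lambda>x. x - U t x)" using W_bdd W_T by (simp add: factor_def)
  then show ?thesis by (simp add: W_def)
qed

text \<open>The operator is \<open>z ^ n exp (z t) (1 - exp (- z t) T t)\<close> plus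
  \<open>z ^ n T t - D n t\<close>. The integral of the rescaled semigroup factors the first
  summand, telescoping the second.\<close>

theorem factorization:
  assumes "t > 0"
  shows "\<exists>L. factor z L (\<lambda>x. (z ^ n * exp (z * of_real t)) *\<^sub>C x - D n t x)"
proof -
  obtain L where "factor z L (\<lambda>x. z ^ n *\<^sub>C T t x - D n t x)"
    using factor_power[OF assms] by blast
  from factor_add[OF rescaled_integral this, of t "z ^ n * exp (z * of_real t)"] assms
  have "\<exists>L. factor z L (\<lambda>x. (z ^ n * exp (z * of_real t)) *\<^sub>C
      (x - exp (- z * of_real t) *\<^sub>C T t x) + (z ^ n *\<^sub>C T t x - D n t x))"
    by (auto simp del: mult_minus_left)
  moreover have "(z ^ n * exp (z * of_real t)) *\<^sub>C (x - exp (- z * of_real t) *\<^sub>C T t x) +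
      (z ^ n *\<^sub>C T t x - D n t x) = (z ^ n * exp (z * of_real t)) *\<^sub>C x - D n t x" for x
    by (simp add: scaleC_diff_right scaleC_scaleC mult.assoc flip: exp_add)
  ultimately show ?thesis by (simp only:)
qed

end

section \<open>Spectra\<close>

lemma approx_point_spectrumI:
  assumes D: "\<And>r x. x \<in> D \<Longrightarrow> r *\<^sub>R x \<in> D" "\<And>r x. x \<in> D \<Longrightarrow> S (r *\<^sub>R x) = r *\<^sub>R S x"
    and small: "\<And>e. e > 0 \<Longrightarrow> \<exists>x\<in>D. norm (z *\<^sub>C x - S x) < e * norm x"
  shows "z \<in> op_approx_point_spectrum D S"
proof -
  have "\<forall>k. \<exists>x. x \<in> D \<and> norm x = 1 \<and> norm (z *\<^sub>C x - S x) \<le> inverse (real (Suc k))"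
  proof
    fix k
    obtain x where x: "x \<in> D" "norm (z *\<^sub>C x - S x) < inverse (real (Suc k)) * norm x"
      using small[of "inverse (real (Suc k))"] by auto
    define u where "u = inverse (norm x) *\<^sub>R x"
    \<comment> \<open>The strict inequality excludes \<open>x = 0\<close>, so \<open>x\<close> can
      be normalised.\<close>
    have "norm x > 0"
      using x(2) by (auto simp: zero_less_mult_iff dest: le_less_trans[OF norm_ge_zero])
    moreover have "z *\<^sub>C u - S u = inverse (norm x) *\<^sub>R (z *\<^sub>C x - S x)"
      using linear_scale[OF bounded_linear.linear[OF bounded_linear_scaleC_right[of z]]]
      by (simp add: u_def D(2)[OF x(1)] scaleR_diff_right)
    then have "norm (z *\<^sub>C u - S u) = norm (z *\<^sub>C x - S x) / norm x"
      by (simp add: divide_inverse_commute)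
    ultimately have "norm (z *\<^sub>C u - S u) \<le> inverse (real (Suc k))" "norm u = 1"
      using x(2) by (simp_all add: u_def pos_divide_le_eq less_imp_le)
    then show "\<exists>x. x \<in> D \<and> norm x = 1 \<and> norm (z *\<^sub>C x - S x) \<le> inverse (real (Suc k))"
      using D(1)[OF x(1)] u_def by blast
  qed
  then obtain x where x: "\<And>k. x k \<in> D" "\<And>k. norm (x k) = 1"
    "\<And>k. norm (z *\<^sub>C x k - S (x k)) \<le> inverse (real (Suc k))"
    by metis
  have "(\<lambda>k. z *\<^sub>C x k - S (x k)) \<longlonglongrightarrow> 0"
    by (rule Lim_null_comparison[OF always_eventually LIMSEQ_inverse_real_of_nat])
      (use x(3) in blast)
  then show ?thesis using x(1,2) by (auto simp: op_approx_point_spectrum_def)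
qed

lemma approx_point_spectrum_not_bounded_below:
  assumes "z \<in> op_approx_point_spectrum D S"
  shows "\<not> (\<exists>C. \<forall>x\<in>D. norm x \<le> C * norm (z *\<^sub>C x - S x))"
proof
  assume "\<exists>C. \<forall>x\<in>D. norm x \<le> C * norm (z *\<^sub>C x - S x)"
  then obtain C where C: "\<And>x. x \<in> D \<Longrightarrow> norm x \<le> C * norm (z *\<^sub>C x - S x)" by blast
  obtain x where x: "\<And>k. x k \<in> D" "\<And>k. norm (x k) = 1" "(\<lambda>k. z *\<^sub>C x k - S (x k)) \<longlonglongrightarrow> 0"
    using assms by (auto simp: op_approx_point_spectrum_def)
  have "(\<lambda>k. C * norm (z *\<^sub>C x k - S (x k))) \<longlonglongrightarrow> C * norm (0 :: 'a)"
    by (intro tendsto_intros x)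
  moreover have "\<And>k. 1 \<le> C * norm (z *\<^sub>C x k - S (x k))" using C x by metis
  ultimately have "(1 :: real) \<le> C * norm (0 :: 'a)" by (intro LIMSEQ_le_const) auto
  then show False by simp
qed

lemma approx_point_spectrum_subset_spectrum: "op_approx_point_spectrum D S \<subseteq> op_spectrum D S"
proof
  fix z assume z: "z \<in> op_approx_point_spectrum D S"
  show "z \<in> op_spectrum D S"
  proof (rule ccontr)
    assume "z \<notin> op_spectrum D S"
    then obtain R where R: "bounded_clinear R" "\<And>x. x \<in> D \<Longrightarrow> R (z *\<^sub>C x - S x) = x"
      by (auto simp: op_spectrum_def op_resolvent_set_def)
    obtain K where "\<And>x. norm (R x) \<le> K * norm x" using bounded_clinear_bound[OF R(1)] by blast
    then have "\<forall>x\<in>D. norm x \<le> K * norm (z *\<^sub>C x - S x)" using R(2) by metis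
    then show False using approx_point_spectrum_not_bounded_below[OF z] by blast
  qed
qed

text \<open>For a subspace \<open>Y\<close> the distance to \<open>Y\<close> is the quotient
  seminorm, and an operator leaving \<open>Y\<close> invariant descends to the quotient with the
  same bound.\<close>

lemma infdist_linear_image_le:
  assumes L: "bounded_linear L" "\<And>x. norm (L x) \<le> K * norm x" "L ` Y \<subseteq> Y" and K: "K \<ge> 0"
  shows "infdist (L x) Y \<le> K * infdist x Y"
\<comment> \<open>The infimum argument divides by \<open>K\<close>, and \<open>infdist\<close> to
  the empty set is 0 by convention, so both degenerate cases are split off.\<close>
proof (cases "Y = {} \<or> K = 0")
  case True
  then show ?thesis
  proof
    assume "K = 0"
    then have "L = (\<lambda>x. 0)" using L(2) by (auto simp: fun_eq_iff)
    then show ?thesis using \<open>K = 0\<close> L(3) by (cases "Y = {}") (auto simp: infdist_def[of _ "{}"])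
  qed (simp add: infdist_def)
next
  case False
  have "infdist (L x) Y / K \<le> (INF y\<in>Y. dist x y)"
  proof (rule cINF_greatest)
    fix y assume "y \<in> Y"
    then have "infdist (L x) Y \<le> dist (L x) (L y)" using L(3) by (intro infdist_le) auto
    also have "\<dots> \<le> K * dist x y"
      using L(2)[of "x - y"] linear_diff[OF bounded_linear.linear[OF L(1)]] by (simp add: dist_norm)
    finally show "infdist (L x) Y / K \<le> dist x y" using False K by (simp add: field_simps)
  qed (use False in auto)
  then show ?thesis using False K by (simp add: infdist_def field_simps)
qed

lemma infdist_subspace_add:
  fixes Y :: "'a::real_normed_vector set"
  assumes "subspace Y"
  shows "infdist (x + y) Y \<le> infdist x Y + infdist y Y"
proof -
  have ne: "Y \<noteq> {}" using subspace_0[OF assms] by auto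
  have "infdist (x + y) Y - infdist y Y \<le> (INF a\<in>Y. dist x a)"
  proof (rule cINF_greatest[OF ne])
    fix a assume a: "a \<in> Y"
    have "infdist (x + y) Y - dist x a \<le> (INF b\<in>Y. dist y b)"
    proof (rule cINF_greatest[OF ne])
      fix b assume b: "b \<in> Y"
      have "infdist (x + y) Y \<le> dist (x + y) (a + b)"
        using a b by (intro infdist_le subspace_add[OF assms])
      also have "\<dots> \<le> dist x a + dist y b" by (rule dist_triangle_add)
      finally show "infdist (x + y) Y - dist x a \<le> dist y b" by simp
    qed
    then show "infdist (x + y) Y - infdist y Y \<le> dist x a" using ne by (simp add: infdist_def)
  qed
  then show ?thesis using ne by (simp add: infdist_def)
qed

text \<open>Outside the approximate point spectrum \<open>w - F\<close> is bounded below, so it is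
  injective and, the space being complete, its range is closed. Were it onto, the lower bound would
  make its inverse bounded.\<close>

lemma spectrum_closed_range:
  fixes F :: "'a::complex_banach \<Rightarrow> 'a"
  assumes F: "bounded_clinear F"
    and w: "w \<in> op_spectrum UNIV F" "w \<notin> op_approx_point_spectrum UNIV F"
  shows "closed (range (\<lambda>x. w *\<^sub>C x - F x)) \<and> range (\<lambda>x. w *\<^sub>C x - F x) \<noteq> UNIV"
proof -
  define G where "G = (\<lambda>x. w *\<^sub>C x - F x)"
  have G: "bounded_clinear G"
    unfolding G_def by (intro bounded_clinear_diff bounded_clinear_scaleC F)
  have "\<not> (\<forall>e>0. \<exists>x\<in>UNIV. norm (w *\<^sub>C x - F x) < e * norm x)"
    using approx_point_spectrumI[of UNIV F w] w(2) bounded_clinearD(7)[OF F] by blast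
  then obtain e where e: "e > 0" "\<And>x. e * norm x \<le> norm (G x)"
    unfolding G_def by (meson UNIV_I not_less)
  have "complete (range G)"
    using complete_isometric_image[OF e(1) subspace_UNIV bounded_clinearD(1)[OF G]] e(2)
      complete_UNIV by auto
  moreover have "range G \<noteq> UNIV"
  proof
    assume "range G = UNIV"
    then obtain R where R: "\<And>y. G (R y) = y" by (metis surj_f_inv_f)
    have inj: "x = y" if "G x = G y" for x y
      using e(2)[of "x - y"] e(1) that by (simp add: bounded_clinearD(3)[OF G] mult_le_0_iff)
    have R_G: "R (G x) = x" for x using inj R by blast
    have R_add: "R (x + y) = R x + R y" for x y
      by (rule inj) (simp add: R bounded_clinearD(2)[OF G])
    have R_scaleC: "R (c *\<^sub>C x) = c *\<^sub>C R x" for c x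
      by (rule inj) (simp add: R bounded_clinearD(6)[OF G])
    have "norm (R y) \<le> norm y * inverse e" for y
      using e(2)[of "R y"] e(1) by (simp add: R field_simps)
    then have "bounded_clinear R"
      unfolding bounded_clinear_def
      using R_add R_scaleC by (auto intro!: bounded_linear_intro simp flip: scaleC_of_real)
    then have "w \<in> op_resolvent_set UNIV F"
      using R R_G unfolding op_resolvent_set_def G_def by blast
    then show False using w(1) by (simp add: op_spectrum_def)
  qed
  ultimately show ?thesis by (simp add: G_def complete_imp_closed)
qed

section \<open>The two inclusions of the spectral mapping\<close>

context differentiable_C0_semigroup
begin

definition symbol :: "nat \<Rightarrow> real \<Rightarrow> complex \<Rightarrow> complex"
  where "symbol n t z = z ^ n * exp (z * of_real t)"

lemma D_bounded: "t > 0 \<Longrightarrow> bounded_clinear (D n t)"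
  by (rule D_facts)

lemma D_commute: "t > 0 \<Longrightarrow> D m t (D n t x) = D n t (D m t x)"
  by (rule commute_D) (auto simp: bounded_clinearD(1)[OF D_bounded] D_facts(3))

lemma factor_symbol:
  assumes "t > 0"
  obtains L where "factor z L (\<lambda>x. symbol n t z *\<^sub>C x - D n t x)"
  using factorization[OF assms] unfolding symbol_def by blast

lemma factor_commute_D:
  assumes "factor z L E" "t > 0"
  shows "L (D n t x) = D n t (L x)"
  using assms by (intro commute_D) (auto simp: factor_def bounded_clinear_def)

lemma generator_D:
  assumes "t > 0" "x \<in> dom_A"
  shows "D n t (A x) = A (D n t x)"
  using assms
  by (intro generator_commute(2)[symmetric]) (auto simp: bounded_clinearD(1)[OF D_bounded] D_facts(3))

text \<open>Needed so that a resolvent of \<open>A\<close> preserves the range of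
  \<open>w - D n t\<close> and hence acts on the quotient by it.\<close>

lemma resolvent_commute_D:
  assumes "t > 0" and R: "\<And>y. R y \<in> dom_A \<and> z *\<^sub>C R y - A (R y) = y"
    "\<And>x. x \<in> dom_A \<Longrightarrow> R (z *\<^sub>C x - A x) = x"
  shows "R (D n t x) = D n t (R x)"
proof -
  have "D n t x = D n t (z *\<^sub>C R x - A (R x))" using R(1) by simp
  also have "\<dots> = z *\<^sub>C D n t (R x) - A (D n t (R x))"
    by (simp only: bounded_clinearD(3,6)[OF D_bounded[OF assms(1)]]
        generator_D[OF assms(1) conjunct1[OF R(1)]])
  finally show ?thesis using R(2) A_D(1)[OF assms(1)] by metis
qed

text \<open>The bounded \<open>L\<close> maps \<open>z x - A x\<close> to
  \<open>symbol n t z x - D n t x\<close>, so the same approximate eigenvectors serve for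
  \<open>D n t\<close>.\<close>

lemma symbol_approx_point_spectrum:
  assumes "t > 0" "z \<in> op_approx_point_spectrum dom_A A"
  shows "symbol n t z \<in> op_approx_point_spectrum UNIV (D n t)"
proof -
  obtain L where L: "factor z L (\<lambda>x. symbol n t z *\<^sub>C x - D n t x)"
    using factor_symbol[OF assms(1)] .
  then have lin: "bounded_linear L" by (simp add: factor_def bounded_clinear_def)
  obtain x where x: "\<And>k. x k \<in> dom_A" "\<And>k. norm (x k) = 1" "(\<lambda>k. z *\<^sub>C x k - A (x k)) \<longlonglongrightarrow> 0"
    using assms(2) by (auto simp: op_approx_point_spectrum_def)
  have "(\<lambda>k. symbol n t z *\<^sub>C x k - D n t (x k)) \<longlonglongrightarrow> 0"
    using bounded_linear.tendsto_zero[OF lin x(3)] by (simp add: factor_generator[OF L x(1)])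
  then show ?thesis using x(2) by (auto simp: op_approx_point_spectrum_def)
qed

text \<open>If \<open>R\<close> inverts \<open>symbol n t z - D n t\<close>, then \<open>L\<close>
  after \<open>R\<close> inverts \<open>z - A\<close>: on the right by \<open>(z - A) L\<close>, on
  the left by \<open>L (z - A)\<close> once \<open>R\<close> is commuted with
  \<open>L\<close>.\<close>

lemma symbol_spectrum:
  assumes "t > 0" "z \<in> op_spectrum dom_A A"
  shows "symbol n t z \<in> op_spectrum UNIV (D n t)"
proof (rule ccontr)
  let ?G = "\<lambda>x. symbol n t z *\<^sub>C x - D n t x"
  assume "\<not> ?thesis"
  then obtain R where R: "bounded_clinear R" "\<And>y. ?G (R y) = y" "\<And>x. R (?G x) = x"
    by (auto simp: op_spectrum_def op_resolvent_set_def)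
  obtain L where L: "factor z L ?G"
    using factor_symbol[OF assms(1)] .
  then have lin: "bounded_clinear L" by (simp add: factor_def)
  have R_L: "R (L y) = L (R y)" for y
  proof -
    have "?G (L (R y)) = L (?G (R y))"
      using factor_commute_D[OF L assms(1)] by (simp add: bounded_clinearD(3,6)[OF lin])
    then show ?thesis using R(2,3) by metis
  qed
  have "L (R y) \<in> dom_A \<and> z *\<^sub>C L (R y) - A (L (R y)) = y" for y
    using L R(2)[of y] by (simp add: factor_def)
  moreover have "L (R (z *\<^sub>C x - A x)) = x" if "x \<in> dom_A" for x
    using factor_generator[OF L that] R(3)[of x] by (simp flip: R_L)
  ultimately have "z \<in> op_resolvent_set dom_A A"
    using bounded_clinear_compose[OF lin R(1)] unfolding op_resolvent_set_def by blast
  then show False using assms(2) by (simp add: op_spectrum_def)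
qed

text \<open>Vectors \<open>v\<close> that are almost eigenvectors of \<open>B\<close> and almost
  killed by \<open>w - D n t\<close> are smoothed to \<open>D n t v\<close>. These lie in the domain
  of \<open>A\<close> and are almost eigenvectors of \<open>A\<close> for the same \<open>z\<close>;
  the factorization then identifies the symbol as \<open>w\<close>.\<close>

lemma seminorm_spectral_value:
  fixes p :: "'a \<Rightarrow> real"
  assumes t: "t > 0" and w: "w \<noteq> 0"
    and p: "\<And>x. p x \<ge> 0" "\<And>x y. p (x + y) \<le> p x + p y" "\<And>c x. p (c *\<^sub>C x) \<le> cmod c * p x"
    and bdd: "\<And>L. bounded_clinear L \<Longrightarrow> (\<And>x. L (D n t x) = D n t (L x)) \<Longrightarrow>
      \<exists>K. \<forall>x. p (L x) \<le> K * p x"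
    and unbounded: "\<not> (\<exists>C. \<forall>v. p v \<le> C * p (w *\<^sub>C v - D n t v))"
  shows "\<exists>z. symbol n t z = w \<and> (\<forall>e>0. \<exists>y\<in>dom_A. p (z *\<^sub>C y - A y) < e * p y)"
proof -
  define F where "F = D n t"
  define B where "B = (\<lambda>x. inverse w *\<^sub>C D (Suc n) t x)"
  have F: "bounded_clinear F" using D_bounded[OF t] by (simp add: F_def)
  have B: "bounded_clinear B"
    unfolding B_def by (intro bounded_clinear_scaleC_compose D_bounded t)
  have B_F: "B (F x) = F (B x)" for x
    using D_commute[OF t, of "Suc n" n x]
    by (simp add: B_def F_def bounded_clinearD(6)[OF D_bounded[OF t]] del: semigroup_deriv.simps)
  have bdd': "\<exists>K>0. \<forall>x. p (L x) \<le> K * p x"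
    if L: "bounded_clinear L" "\<And>x. L (F x) = F (L x)" for L
  proof -
    obtain K where "\<And>x. p (L x) \<le> K * p x" using bdd[OF L(1)] L(2) unfolding F_def by blast
    then have "p (L x) \<le> max K 1 * p x" for x
      using p(1)[of x] by (meson max.cobounded1 mult_right_mono order_trans)
    then show ?thesis by (intro exI[of _ "max K 1"]) auto
  qed
  obtain K where K: "K > 0" "\<And>x. p (B x) \<le> K * p x" using bdd'[OF B B_F] by blast
  interpret commuting_seminorm p B "\<lambda>v. w *\<^sub>C v - F v" K
    by unfold_locales
      (simp_all add: p K B_F bounded_clinearD[OF B] bounded_clinearD[OF F] scaleC_algebra mult.commute)
  obtain z where z: "\<And>c C. c > 0 \<Longrightarrow> C \<ge> 0 \<Longrightarrow>
      \<exists>v. p (z *\<^sub>C v - B v) + C * p (w *\<^sub>C v - F v) < c * p v"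
    using joint_approximate_eigenvalue unbounded unfolding F_def by blast
  obtain L where L: "factor z L (\<lambda>x. symbol n t z *\<^sub>C x - F x)"
    unfolding F_def using factor_symbol[OF t] .
  have "bounded_clinear L" "L (F x) = F (L x)" for x
    using L factor_commute_D[OF L t] by (simp_all add: factor_def F_def)
  from bdd'[OF this] obtain KL where KL: "KL > 0" "\<And>x. p (L x) \<le> KL * p x" by blast
  obtain KF where KF: "KF > 0" "\<And>x. p (F x) \<le> KF * p x" using bdd'[OF F] by blast
  \<comment> \<open>For \<open>c \<le> a\<close> the smoothed vector \<open>y\<close> satisfies
    \<open>p y \<ge> a * p v\<close>, which is why \<open>a\<close> is a divisor below.
    \<open>M1\<close> and \<open>M2\<close> collect the constants, relative to \<open>p y\<close>,
    in the estimates of \<open>z y - A y\<close> and of \<open>(symbol n t z - w) y\<close>.\<close>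
  define a where "a = cmod w / 2"
  have a: "a > 0" using w by (simp add: a_def)
  define M1 where "M1 = (cmod z + cmod w) / a"
  define M2 where "M2 = KL * M1 + KF / a"
  have M1: "M1 > 0" unfolding M1_def using a w by (intro divide_pos_pos add_nonneg_pos) auto
  have M2: "M2 > 0" unfolding M2_def using a M1 KL KF by (intro add_pos_pos) auto
  have main: "\<exists>y\<in>dom_A. p (z *\<^sub>C y - A y) < M1 * c * p y \<and> cmod (symbol n t z - w) < M2 * c"
    if c: "0 < c" "c \<le> a" for c
  proof -
    obtain v where v: "p (z *\<^sub>C v - B v) + p (w *\<^sub>C v - F v) < c * p v"
      using z[of c 1] c by auto
    define y where "y = F v"
    define r s where "r = p (z *\<^sub>C v - B v)" and "s = p (w *\<^sub>C v - F v)"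
    have rs: "0 \<le> r" "0 \<le> s" "r + s < c * p v" using v p(1) by (simp_all add: r_def s_def)
    have pv: "p v > 0" using rs c p(1)[of v] by (smt (verit) mult_nonneg_nonneg zero_less_mult_pos)
    have "cmod w * p v \<le> s + p y"
      using p(2)[of "w *\<^sub>C v - F v" y] p_scaleC_eq[of w v] by (simp add: s_def y_def)
    moreover have "s \<le> a * p v" using rs mult_right_mono[OF c(2) p(1)[of v]] by linarith
    ultimately have py: "a * p v \<le> p y" by (simp add: a_def)
    then have py0: "p y > 0" using a pv by (smt (verit) mult_pos_pos)
    have A_y: "A y = w *\<^sub>C B v" using w t by (simp add: y_def F_def B_def A_D scaleC_scaleC)
    have "z *\<^sub>C y - A y = w *\<^sub>C (z *\<^sub>C v - B v) + (- z) *\<^sub>C (w *\<^sub>C v - F v)"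
      unfolding A_y by (simp add: y_def scaleC_algebra mult.commute)
    then have "p (z *\<^sub>C y - A y) \<le> cmod w * r + cmod z * s"
      using p(2)[of "w *\<^sub>C (z *\<^sub>C v - B v)" "(- z) *\<^sub>C (w *\<^sub>C v - F v)"]
        p(3)[of w "z *\<^sub>C v - B v"] p(3)[of "- z" "w *\<^sub>C v - F v"] by (simp add: r_def s_def)
    also have "\<dots> \<le> (cmod z + cmod w) * (r + s)"
      using rs by (simp add: algebra_simps)
    also have "\<dots> < (cmod z + cmod w) * (c * p v)"
      using rs w by (intro mult_strict_left_mono add_nonneg_pos) auto
    also have "\<dots> = M1 * c * (a * p v)"
      using a by (simp add: M1_def)
    also have "\<dots> \<le> M1 * c * p y"
      using py M1 c by (intro mult_left_mono) auto
    finally have *: "p (z *\<^sub>C y - A y) < M1 * c * p y" .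
    have y_dom: "y \<in> dom_A" using t by (simp add: y_def F_def A_D)
    \<comment> \<open>The number \<open>symbol n t z - w\<close> is isolated as a multiple of
      \<open>y\<close>: adding \<open>- F (w v - F v) = F y - w y\<close> trades the
      \<open>F y\<close> of the factorization for \<open>w y\<close>, and both summands are
      small.\<close>
    have "(symbol n t z - w) *\<^sub>C y = L (z *\<^sub>C y - A y) + (- 1) *\<^sub>C F (w *\<^sub>C v - F v)"
      unfolding factor_generator[OF L y_dom]
      by (simp add: scaleC_algebra bounded_clinearD[OF F] y_def)
    then have "cmod (symbol n t z - w) * p y \<le> p (L (z *\<^sub>C y - A y)) + p (F (w *\<^sub>C v - F v))"
      using p(2)[of "L (z *\<^sub>C y - A y)" "(- 1) *\<^sub>C F (w *\<^sub>C v - F v)"]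
        p(3)[of "- 1" "F (w *\<^sub>C v - F v)"] p_scaleC_eq[of "symbol n t z - w" y] by simp
    also have "\<dots> \<le> KL * p (z *\<^sub>C y - A y) + KF * s"
      unfolding s_def by (intro add_mono KL KF)
    also have "\<dots> < KL * (M1 * c * p y) + KF * (c * p v)"
      using KL KF * rs by (intro add_strict_mono mult_strict_left_mono) auto
    also have "\<dots> = KL * (M1 * c * p y) + KF / a * c * (a * p v)"
      using a by simp
    also have "\<dots> \<le> KL * (M1 * c * p y) + KF / a * c * p y"
      using py a c KF by (intro add_left_mono mult_left_mono) auto
    also have "\<dots> = M2 * c * p y" by (simp add: M2_def algebra_simps)
    finally have "cmod (symbol n t z - w) < M2 * c" using py0 by simp
    then show ?thesis using * y_dom by blast
  qed
  have "symbol n t z = w"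
  proof (rule ccontr)
    assume "symbol n t z \<noteq> w"
    then have d: "cmod (symbol n t z - w) > 0" by simp
    define c where "c = min a (cmod (symbol n t z - w) / M2)"
    have "0 < c" "c \<le> a" "M2 * c \<le> cmod (symbol n t z - w)"
      using a M2 d by (auto simp: c_def min_def field_simps)
    then show False using main[of c] by auto
  qed
  moreover have "\<exists>y\<in>dom_A. p (z *\<^sub>C y - A y) < e * p y" if "e > 0" for e
  proof -
    define c where "c = min a (e / M1)"
    have c: "0 < c" "c \<le> a" "M1 * c \<le> e"
      using a M1 that by (auto simp: c_def min_def field_simps)
    then obtain y where "y \<in> dom_A" "p (z *\<^sub>C y - A y) < M1 * c * p y" using main by blast
    moreover have "M1 * c * p y \<le> e * p y" using c p(1) by (intro mult_right_mono)
    ultimately show ?thesis by force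
  qed
  ultimately show ?thesis by blast
qed

lemma approx_point_spectrum_symbol:
  assumes t: "t > 0" and w: "w \<noteq> 0" "w \<in> op_approx_point_spectrum UNIV (D n t)"
  shows "\<exists>z \<in> op_approx_point_spectrum dom_A A. symbol n t z = w"
proof -
  have "\<exists>z. symbol n t z = w \<and> (\<forall>e>0. \<exists>y\<in>dom_A. norm (z *\<^sub>C y - A y) < e * norm y)"
  proof (rule seminorm_spectral_value[OF t w(1)])
    show "\<not> (\<exists>C. \<forall>v. norm v \<le> C * norm (w *\<^sub>C v - D n t v))"
      using approx_point_spectrum_not_bounded_below[OF w(2)] by simp
    show "\<exists>K. \<forall>x. norm (L x) \<le> K * norm x" if "bounded_clinear L" for L :: "'a \<Rightarrow> 'a"
      using bounded_clinear_bound[OF that] by blast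
  qed (auto simp: norm_triangle_ineq norm_scaleC)
  then obtain z where z: "symbol n t z = w"
    "\<And>e. e > 0 \<Longrightarrow> \<exists>y\<in>dom_A. norm (z *\<^sub>C y - A y) < e * norm y" by blast
  have "z \<in> op_approx_point_spectrum dom_A A"
    using approx_point_spectrumI[of dom_A A z] A_scaleC z(2) by (simp flip: scaleC_of_real)
  then show ?thesis using z(1) by blast
qed

text \<open>When \<open>w - D n t\<close> has a proper closed range \<open>Y\<close>, the distance
  to \<open>Y\<close> vanishes on that range but not everywhere, so \<open>w - D n t\<close> is as
  far from bounded below as possible. Approximate eigenvectors of \<open>A\<close> in this distance
  exclude a resolvent at \<open>z\<close>.\<close>

lemma spectrum_symbol:
  assumes t: "t > 0" and w: "w \<noteq> 0" "w \<in> op_spectrum UNIV (D n t)"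
  shows "\<exists>z \<in> op_spectrum dom_A A. symbol n t z = w"
proof (cases "w \<in> op_approx_point_spectrum UNIV (D n t)")
  case True
  then show ?thesis
    using approx_point_spectrum_symbol[OF t w(1)] approx_point_spectrum_subset_spectrum by blast
next
  case False
  define G where "G = (\<lambda>x. w *\<^sub>C x - D n t x)"
  define Y where "Y = range G"
  have Y: "closed Y" "Y \<noteq> UNIV"
    using spectrum_closed_range[OF D_bounded[OF t] w(2) False] by (auto simp: Y_def G_def)
  have G: "bounded_clinear G"
    unfolding G_def by (intro bounded_clinear_diff bounded_clinear_scaleC D_bounded t)
  have Y_ne: "Y \<noteq> {}" by (simp add: Y_def)
  have sub: "subspace Y"
    unfolding Y_def using bounded_clinearD(1)[OF G]
    by (intro linear_subspace_image bounded_linear.linear) auto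
  have Y_L: "L ` Y \<subseteq> Y" if "bounded_clinear L" "\<And>x. L (D n t x) = D n t (L x)" for L
  proof -
    have "L (G x) = G (L x)" for x using that by (simp add: G_def bounded_clinearD(3,6))
    then show ?thesis by (auto simp: Y_def)
  qed
  have bdd: "\<exists>K. \<forall>x. infdist (L x) Y \<le> K * infdist x Y"
    if L: "bounded_clinear L" "\<And>x. L (D n t x) = D n t (L x)" for L
  proof -
    obtain K where K: "K > 0" "\<And>x. norm (L x) \<le> K * norm x"
      using bounded_clinear_bound[OF L(1)] by blast
    have "infdist (L x) Y \<le> K * infdist x Y" for x
      by (rule infdist_linear_image_le)
        (use K L Y_L bounded_clinearD(1) in auto)
    then show ?thesis by blast
  qed
  have "\<exists>z. symbol n t z = w \<and> (\<forall>e>0. \<exists>y\<in>dom_A. infdist (z *\<^sub>C y - A y) Y < e * infdist y Y)"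
  proof (rule seminorm_spectral_value[OF t w(1)])
    show "infdist (x + y) Y \<le> infdist x Y + infdist y Y" for x y
      by (rule infdist_subspace_add[OF sub])
    show "infdist (c *\<^sub>C x) Y \<le> cmod c * infdist x Y" for c x
      by (rule infdist_linear_image_le)
        (use Y_L[OF bounded_clinear_scaleC] bounded_clinearD(6)[OF D_bounded[OF t]] in
          \<open>auto simp: bounded_linear_scaleC_right norm_scaleC\<close>)
    obtain v where "v \<notin> Y" using Y(2) by auto
    then have "infdist v Y > 0" using Y(1) Y_ne by (intro infdist_pos_not_in_closed)
    moreover have "infdist (w *\<^sub>C v - D n t v) Y = 0" by (rule infdist_zero) (simp add: Y_def G_def)
    ultimately show "\<not> (\<exists>C. \<forall>v. infdist v Y \<le> C * infdist (w *\<^sub>C v - D n t v) Y)"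
      by (metis mult_zero_right not_less)
  qed (use bdd infdist_nonneg in auto)
  then obtain z where z: "symbol n t z = w"
    "\<And>e. e > 0 \<Longrightarrow> \<exists>y\<in>dom_A. infdist (z *\<^sub>C y - A y) Y < e * infdist y Y" by blast
  have "z \<in> op_spectrum dom_A A"
  proof (rule ccontr)
    assume "z \<notin> op_spectrum dom_A A"
    then obtain R where R: "bounded_clinear R" "\<And>y. R y \<in> dom_A \<and> z *\<^sub>C R y - A (R y) = y"
      "\<And>x. x \<in> dom_A \<Longrightarrow> R (z *\<^sub>C x - A x) = x"
      by (auto simp: op_spectrum_def op_resolvent_set_def)
    obtain K where K: "\<And>x. infdist (R x) Y \<le> K * infdist x Y"
      using bdd[OF R(1) resolvent_commute_D[OF t R(2,3)]] by blast
    \<comment> \<open>\<open>K\<close> may fail to be positive; \<open>M\<close> can be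
      inverted.\<close>
    define M where "M = max K 1"
    have M: "M > 0" "K \<le> M" by (auto simp: M_def)
    obtain y where y: "y \<in> dom_A" "infdist (z *\<^sub>C y - A y) Y < inverse M * infdist y Y"
      using z(2)[of "inverse M"] M by auto
    have "infdist y Y \<le> K * infdist (z *\<^sub>C y - A y) Y"
      using K[of "z *\<^sub>C y - A y"] R(3)[OF y(1)] by simp
    also have "\<dots> \<le> M * infdist (z *\<^sub>C y - A y) Y"
      using M by (intro mult_right_mono infdist_nonneg)
    also have "\<dots> < M * (inverse M * infdist y Y)"
      using M y by (intro mult_strict_left_mono)
    also have "\<dots> = infdist y Y" using M by simp
    finally show False by simp
  qed
  then show ?thesis using z(1) by blast
qed

end

theorem corollary4:
  fixes T :: "real \<Rightarrow> 'a::complex_banach \<Rightarrow> 'a"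
    and n :: nat and t :: real
    and spec :: "'a set \<Rightarrow> ('a \<Rightarrow> 'a) \<Rightarrow> complex set"
  assumes "differentiable_semigroup T"
    and "n \<ge> 1" and "t > 0"
    and "spec \<in> {op_spectrum, op_approx_point_spectrum}"
  shows "spec UNIV (semigroup_deriv T n t) \<union> {0} =
    {z ^ n * exp (z * complex_of_real t) |z.
       z \<in> spec (generator_domain T) (generator T) \<union> {0}}"
proof -
  interpret differentiable_C0_semigroup T by unfold_locales (rule assms)
  have fwd: "symbol n t z \<in> spec UNIV (D n t)" if "z \<in> spec dom_A A" for z
    using assms(3,4) that symbol_spectrum symbol_approx_point_spectrum by auto
  have bwd: "\<exists>z \<in> spec dom_A A. symbol n t z = w" if "w \<in> spec UNIV (D n t)" "w \<noteq> 0" for w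
    using assms(3,4) that spectrum_symbol approx_point_spectrum_symbol by auto
  \<comment> \<open>Here \<open>n \<ge> 1\<close> enters: the point 0 adjoined to the spectrum of
    \<open>A\<close> maps to the 0 adjoined on the left, so only nonzero \<open>w\<close> need a
    preimage.\<close>
  have "symbol n t 0 = 0" using assms(2) by (simp add: symbol_def)
  then have "spec UNIV (D n t) \<union> {0} = {symbol n t z |z. z \<in> spec dom_A A \<union> {0}}"
    using fwd bwd by (auto simp: set_eq_iff) metis+
  then show ?thesis by (simp add: symbol_def)
qed

end
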